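(* Let $n\ge0$. Let $\tilde c^n_{i,j}$ be the conductance between $x_i$ and $x_j$ for the set $\{x_0,\dots,x_{2^n}\}$ (the bottom row of $V_n$), let $c^n_{i,j}$ be the conductance between $x_i$ and $x_j$ for the set $\{x_0,\dots,x_{2^n}\}\cup\{q_0\}$ (the bottom row together with the top point), and let $a_n$ be the conductance between $q_0$ and $x_0$ for the latter set. Then $$\tilde c^n_{0,2^n}=c^n_{0,2^n}+\frac{a_n}{2^{n+1}},$$ $$\tilde c^n_{0,j}=c^n_{0,j}+\frac{a_n}{2^n}\quad(0<j<2^n),\qquad \tilde c^n_{i,j}=c^n_{i,j}+\frac{a_n}{2^{n-1}}\quad(0<i<j<2^n).$$
   Context: Let $q_0,q_1,q_2$ be the vertices of an equilateral triangle in the plane, $F_i(x)=\frac12(x+q_i)$, and let $SG$ (the Sierpinski gasket) be the unique nonempty compact set with $SG=\bigcup_{i}F_i(SG)$. For a word $w$ of length $m$ let $F_w=F_{w_1}\circ\cdots\circ F_{w_m}$. Put $V_0=\{q_0,q_1,q_2\}$, $V_m=\bigcup_iF_iV_{m-1}$; $x\sim_m y$ means $x\ne y$ and $x,y\in F_wV_0$ for some word $w$ of length $m$. The bottom row of $V_n$ consists of the points $x_i=q_1+\frac{i}{2^n}(q_2-q_1)$, $0\le i\le2^n$. The energy of a continuous $u:SG\to\mathbb{R}$ is $\mathcal{E}(u)=\lim_{m\to\infty}\left(\frac53\right)^m\sum_{\{x,y\}:x\sim_m y}(u(x)-u(y))^2$ (a nondecreasing limit), and $\operatorname{dom}\mathcal{E}$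 is the set of continuous $u$ with $\mathcal{E}(u)<\infty$. For a nonempty set $A\subset V_n$ and values prescribed on $A$, there is a unique $u\in\operatorname{dom}\mathcal{E}$ of least energy with these values on $A$, and its energy has the form $\mathcal{E}(u)=\sum_{\{x,y\}\subset A}c_{x,y}(u(x)-u(y))^2$; the (uniquely determined, symmetric) coefficients $c_{x,y}$, $x\neq y$, are the conductances for the set $A$. *)

theory Defs
  imports "HOL-Analysis.Analysis"
begin

text \<open>
  Throughout, the vertices of the triangle are given by a map \<open>q :: nat \<Rightarrow> real^2\<close>, of which only
  the values at 0, 1, 2 are used; accordingly words are lists over \<open>{..<3}\<close>.
\<close>

definition equilateral :: "(nat \<Rightarrow> real^2) \<Rightarrow> bool" where
  "equilateral q \<longleftrightarrow>
     q 0 \<noteq> q 1 \<and> dist (q 0) (q 1) = dist (q 1) (q 2) \<and> dist (q 1) (q 2) = dist (q 2) (q 0)"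

definition F :: "(nat \<Rightarrow> real^2) \<Rightarrow> nat \<Rightarrow> real^2 \<Rightarrow> real^2" where
  "F q i x = (1/2) *\<^sub>R (x + q i)"

definition SG :: "(nat \<Rightarrow> real^2) \<Rightarrow> (real^2) set" where
  "SG q = (THE K. compact K \<and> K \<noteq> {} \<and> K = (\<Union>i<3. F q i ` K))"

primrec Fword :: "(nat \<Rightarrow> real^2) \<Rightarrow> nat list \<Rightarrow> real^2 \<Rightarrow> real^2" where
  "Fword q [] = id"
| "Fword q (i # w) = F q i \<circ> Fword q w"

primrec V :: "(nat \<Rightarrow> real^2) \<Rightarrow> nat \<Rightarrow> (real^2) set" where
  "V q 0 = q ` {..<3}"
| "V q (Suc m) = (\<Union>i<3. F q i ` V q m)"

definition adj :: "(nat \<Rightarrow> real^2) \<Rightarrow> nat \<Rightarrow> real^2 \<Rightarrow> real^2 \<Rightarrow> bool" where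
  "adj q m x y \<longleftrightarrow> x \<noteq> y \<and>
     (\<exists>w. length w = m \<and> set w \<subseteq> {..<3} \<and> x \<in> Fword q w ` V q 0 \<and> y \<in> Fword q w ` V q 0)"

text \<open>
  A sum over unordered pairs \<open>{x,y}\<close> is written as half of the sum over ordered pairs, both
  in the level-\<open>m\<close> energy and in the quadratic form defining the conductances.
\<close>

definition graph_energy :: "(nat \<Rightarrow> real^2) \<Rightarrow> nat \<Rightarrow> (real^2 \<Rightarrow> real) \<Rightarrow> real" where
  "graph_energy q m u = (5/3)^m * ((\<Sum>(x,y) \<in> {(x,y). adj q m x y}. (u x - u y)\<^sup>2) / 2)"

text \<open>
  Functions on \<open>SG q\<close> are represented by functions on the whole plane whose values off
  \<open>SG q\<close> are irrelevant. The energy is extended-real valued: the sequence of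
  level-\<open>m\<close> energies is nondecreasing, so the limit exists but may be infinite.
\<close>

definition energy :: "(nat \<Rightarrow> real^2) \<Rightarrow> (real^2 \<Rightarrow> real) \<Rightarrow> ereal" where
  "energy q u = lim (\<lambda>m. ereal (graph_energy q m u))"

definition dom_energy :: "(nat \<Rightarrow> real^2) \<Rightarrow> (real^2 \<Rightarrow> real) set" where
  "dom_energy q = {u. continuous_on (SG q) u \<and> energy q u < \<infinity>}"

definition least_energy_extension ::
    "(nat \<Rightarrow> real^2) \<Rightarrow> (real^2) set \<Rightarrow> (real^2 \<Rightarrow> real) \<Rightarrow> (real^2 \<Rightarrow> real) \<Rightarrow> bool" where
  "least_energy_extension q A f u \<longleftrightarrow>
     u \<in> dom_energy q \<and> (\<forall>x\<in>A. u x = f x) \<and>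
     (\<forall>v \<in> dom_energy q. (\<forall>x\<in>A. v x = f x) \<longrightarrow> energy q u \<le> energy q v)"

text \<open>
  Conductances are indexed by pairs of distinct points of \<open>A\<close>; the representing function is
  set to 0 elsewhere, so that it is unique as a function on the plane.
\<close>

definition is_conductances ::
    "(nat \<Rightarrow> real^2) \<Rightarrow> (real^2) set \<Rightarrow> (real^2 \<Rightarrow> real^2 \<Rightarrow> real) \<Rightarrow> bool" where
  "is_conductances q A c \<longleftrightarrow>
     (\<forall>x y. c x y = c y x) \<and>
     (\<forall>x y. x \<notin> A \<or> y \<notin> A \<or> x = y \<longrightarrow> c x y = 0) \<and>
     (\<forall>f u. least_energy_extension q A f u \<longrightarrow>
        energy q u = ereal ((\<Sum>x\<in>A. \<Sum>y\<in>A. c x y * (u x - u y)\<^sup>2) / 2))"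

definition conductance ::
    "(nat \<Rightarrow> real^2) \<Rightarrow> (real^2) set \<Rightarrow> real^2 \<Rightarrow> real^2 \<Rightarrow> real" where
  "conductance q A = (THE c. is_conductances q A c)"

definition bottom_pt :: "(nat \<Rightarrow> real^2) \<Rightarrow> nat \<Rightarrow> nat \<Rightarrow> real^2" where
  "bottom_pt q n i = q 1 + (real i / 2^n) *\<^sub>R (q 2 - q 1)"

definition bottom_row :: "(nat \<Rightarrow> real^2) \<Rightarrow> nat \<Rightarrow> (real^2) set" where
  "bottom_row q n = bottom_pt q n ` {0..2^n}"

definition c_bottom :: "(nat \<Rightarrow> real^2) \<Rightarrow> nat \<Rightarrow> nat \<Rightarrow> nat \<Rightarrow> real" where
  "c_bottom q n i j = conductance q (bottom_row q n) (bottom_pt q n i) (bottom_pt q n j)"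

definition c_bottom_top :: "(nat \<Rightarrow> real^2) \<Rightarrow> nat \<Rightarrow> nat \<Rightarrow> nat \<Rightarrow> real" where
  "c_bottom_top q n i j =
     conductance q (bottom_row q n \<union> {q 0}) (bottom_pt q n i) (bottom_pt q n j)"

definition a_top :: "(nat \<Rightarrow> real^2) \<Rightarrow> nat \<Rightarrow> real" where
  "a_top q n = conductance q (bottom_row q n \<union> {q 0}) (q 0) (bottom_pt q n 0)"

end

theory Submission
  imports Defs
begin

text \<open>
  Among the functions with value \<open>t\<close> at \<open>q 0\<close> and values \<open>f\<close> on the bottom row of level \<open>n\<close>,
  the least energy is \<open>\<alpha>\<^sub>n (t - m\<^sub>n f)\<^sup>2 + R\<^sub>n f\<close>, where \<open>m\<^sub>n\<close> is the trapezoidal mean and \<open>R\<^sub>n\<close> is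
  a quadratic form in differences. This follows by induction on \<open>n\<close>: the cells \<open>F 1\<close> and \<open>F 2\<close>
  carry bottom rows of level \<open>n\<close> and meet the cell \<open>F 0\<close> only in their top points, and one minimizes
  over the values at these two points. Taking \<open>t = m\<^sub>n f\<close> shows that \<open>R\<^sub>n\<close> is the least energy for
  the bottom row alone. Let \<open>w\<close> be the weights of \<open>m\<^sub>n\<close>. The variance identity
  \<open>(t - m f)\<^sup>2 = \<Sum>\<^sub>i w\<^sub>i (t - f\<^sub>i)\<^sup>2 - \<Sum>\<^bsub>i<j\<^esub> w\<^sub>i w\<^sub>j (f\<^sub>i - f\<^sub>j)\<^sup>2\<close> shows that adding the top point creates
  the conductances \<open>\<alpha>\<^sub>n w\<^sub>i\<close> to \<open>q 0\<close> and lowers the one between \<open>x\<^sub>i\<close> and \<open>x\<^sub>j\<close> by \<open>\<alpha>\<^sub>n w\<^sub>i w\<^sub>j\<close>.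
\<close>

section \<open>Quadratic forms in differences\<close>

definition diff_form :: "'a set \<Rightarrow> ('a \<Rightarrow> 'a \<Rightarrow> real) \<Rightarrow> ('a \<Rightarrow> real) \<Rightarrow> real" where
  "diff_form A c f = (\<Sum>x\<in>A. \<Sum>y\<in>A. c x y * (f x - f y)\<^sup>2) / 2"

definition symmetric_on :: "'a set \<Rightarrow> ('a \<Rightarrow> 'a \<Rightarrow> real) \<Rightarrow> bool" where
  "symmetric_on A c \<longleftrightarrow> (\<forall>x y. c x y = c y x) \<and> (\<forall>x y. x \<notin> A \<or> y \<notin> A \<or> x = y \<longrightarrow> c x y = 0)"

definition is_diff_form :: "'a set \<Rightarrow> (('a \<Rightarrow> real) \<Rightarrow> real) \<Rightarrow> bool" where
  "is_diff_form A g \<longleftrightarrow> (\<exists>c. symmetric_on A c \<and> (\<forall>f. g f = diff_form A c f))"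

text \<open>Polarization: the coefficient differences define a vanishing quadratic form, hence a
  vanishing bilinear form, and testing it on two point indicators isolates a single
  coefficient.\<close>

lemma diff_form_coeff_unique:
  assumes "finite A" "symmetric_on A c" "symmetric_on A d"
    and eq: "\<And>f. diff_form A c f = diff_form A d f"
  shows "c = d"
proof (intro ext)
  fix a b
  define e where "e = (\<lambda>x y. c x y - d x y)"
  have sym: "e x y = e y x" for x y
    using assms by (simp add: e_def symmetric_on_def)
  have zero: "(\<Sum>x\<in>A. \<Sum>y\<in>A. e x y * (f x - f y)\<^sup>2) = 0" for f
    using eq[of f] by (simp add: diff_form_def e_def left_diff_distrib sum_subtractf)
  have polar: "(\<Sum>x\<in>A. \<Sum>y\<in>A. e x y * ((f x - f y) * (g x - g y))) = 0" for f g
  proof -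
    have "(\<Sum>x\<in>A. \<Sum>y\<in>A. e x y * ((f x + g x) - (f y + g y))\<^sup>2) =
      (\<Sum>x\<in>A. \<Sum>y\<in>A. e x y * (f x - f y)\<^sup>2) + (\<Sum>x\<in>A. \<Sum>y\<in>A. e x y * (g x - g y)\<^sup>2)
        + 2 * (\<Sum>x\<in>A. \<Sum>y\<in>A. e x y * ((f x - f y) * (g x - g y)))"
      unfolding sum_distrib_left sum.distrib[symmetric]
      by (intro sum.cong refl) (simp add: power2_eq_square algebra_simps)
    then show ?thesis
      using zero[of f] zero[of g] zero[of "\<lambda>x. f x + g x"] by simp
  qed
  show "c a b = d a b"
  proof (cases "a \<in> A \<and> b \<in> A \<and> a \<noteq> b")
    case True
    have "0 = (\<Sum>x\<in>A. \<Sum>y\<in>A. e x y * ((of_bool (x = a) - of_bool (y = a)) * (of_bool (x = b) - of_bool (y = b))))"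
      by (rule polar[symmetric])
    \<comment> \<open>Since \<open>a\<close> and \<open>b\<close> differ, the product is -1 at the
      pairs \<open>(a, b)\<close> and \<open>(b, a)\<close> and 0 elsewhere.\<close>
    also have "\<dots> = (\<Sum>x\<in>A. \<Sum>y\<in>A. - (if y = b then if x = a then e x y else 0 else 0) - (if y = a then if x = b then e x y else 0 else 0))"
      using True by (intro sum.cong refl) auto
    also have "\<dots> = - e a b - e b a"
      using True \<open>finite A\<close> by (simp add: sum_subtractf sum_negf sum.delta)
    finally show ?thesis using sym[of a b] by (simp add: e_def)
  next
    case False
    then show ?thesis using assms unfolding symmetric_on_def by metis
  qed
qed

lemma is_diff_form_add:
  assumes "is_diff_form A g" "is_diff_form A h"
  shows "is_diff_form A (\<lambda>f. g f + h f)"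
proof -
  obtain c d where "symmetric_on A c" "\<And>f. g f = diff_form A c f"
    "symmetric_on A d" "\<And>f. h f = diff_form A d f"
    using assms unfolding is_diff_form_def by blast
  then show ?thesis unfolding is_diff_form_def
    by (intro exI[of _ "\<lambda>x y. c x y + d x y"])
      (simp (no_asm_simp) add: symmetric_on_def diff_form_def distrib_right sum.distrib add_divide_distrib; simp add: symmetric_on_def)
qed

lemma is_diff_form_scale:
  assumes "is_diff_form A g"
  shows "is_diff_form A (\<lambda>f. k * g f)"
proof -
  obtain c where "symmetric_on A c" "\<And>f. g f = diff_form A c f"
    using assms unfolding is_diff_form_def by blast
  then show ?thesis unfolding is_diff_form_def
    by (intro exI[of _ "\<lambda>x y. k * c x y"])
      (auto simp: symmetric_on_def diff_form_def sum_distrib_left mult.assoc)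
qed

text \<open>The coefficients are carried along \<open>h\<close> and extended by 0. This moves forms
  on a bottom row to either half of the next one.\<close>

lemma is_diff_form_pullback:
  assumes g: "is_diff_form A g" and h: "inj_on h A" "h ` A \<subseteq> B" and B: "finite B"
  shows "is_diff_form B (\<lambda>f. g (f \<circ> h))"
proof -
  obtain c where c: "symmetric_on A c" "\<And>f. g f = diff_form A c f"
    using g unfolding is_diff_form_def by blast
  define k where "k = (\<lambda>x y. if x \<in> h ` A \<and> y \<in> h ` A then c (inv_into A h x) (inv_into A h y) else 0)"
  have k: "k (h x) (h y) = c x y" if "x \<in> A" "y \<in> A" for x y
    using that h by (simp add: k_def)
  have "symmetric_on B k"
    unfolding symmetric_on_def
  proof (intro conjI allI impI)
    show "k x y = k y x" for x y using c by (simp add: k_def symmetric_on_def)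
    show "k x y = 0" if "x \<notin> B \<or> y \<notin> B \<or> x = y" for x y
      using that h c unfolding symmetric_on_def k_def by auto
  qed
  moreover have "g (f \<circ> h) = diff_form B k f" for f
  proof -
    have "(\<Sum>x\<in>B. \<Sum>y\<in>B. k x y * (f x - f y)\<^sup>2) = (\<Sum>x\<in>h`A. \<Sum>y\<in>h`A. k x y * (f x - f y)\<^sup>2)"
    proof -
      have "(\<Sum>y\<in>B. k x y * (f x - f y)\<^sup>2) = (\<Sum>y\<in>h`A. k x y * (f x - f y)\<^sup>2)" for x
        using h B by (intro sum.mono_neutral_right) (auto simp: k_def)
      moreover have "(\<Sum>x\<in>B. \<Sum>y\<in>h`A. k x y * (f x - f y)\<^sup>2) = (\<Sum>x\<in>h`A. \<Sum>y\<in>h`A. k x y * (f x - f y)\<^sup>2)"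
        using h B by (intro sum.mono_neutral_right) (auto simp: k_def)
      ultimately show ?thesis by simp
    qed
    also have "\<dots> = (\<Sum>x\<in>A. \<Sum>y\<in>A. c x y * (f (h x) - f (h y))\<^sup>2)"
      using h by (simp add: sum.reindex k)
    finally show ?thesis by (simp add: c diff_form_def)
  qed
  ultimately show ?thesis unfolding is_diff_form_def by blast
qed

text \<open>Variance identity with the total weight left free: total 0 turns the square of a linear
  form into a form in differences, and total 1 gives the usual variance of the row values.\<close>

lemma sum_pair_weights:
  fixes v f :: "'a \<Rightarrow> real"
  shows "(\<Sum>x\<in>A. \<Sum>y\<in>A. v x * v y * (f x - f y)\<^sup>2) / 2 =
    sum v A * (\<Sum>x\<in>A. v x * (f x)\<^sup>2) - (\<Sum>x\<in>A. v x * f x)\<^sup>2"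
proof -
  have "(\<Sum>x\<in>A. \<Sum>y\<in>A. v x * v y * (f x - f y)\<^sup>2) =
    (\<Sum>x\<in>A. \<Sum>y\<in>A. (v x * (f x)\<^sup>2) * v y + v x * (v y * (f y)\<^sup>2) - 2 * ((v x * f x) * (v y * f y)))"
    by (intro sum.cong refl) (simp add: power2_eq_square algebra_simps)
  also have "\<dots> = 2 * (sum v A * (\<Sum>x\<in>A. v x * (f x)\<^sup>2)) - 2 * (\<Sum>x\<in>A. v x * f x)\<^sup>2"
    by (simp add: sum_subtractf sum.distrib power2_eq_square
        flip: sum_distrib_left sum_distrib_right)
  finally show ?thesis by simp
qed

text \<open>The number \<open>s\<close> is the value of the form on the constant 1; it is tracked so
  that forms vanishing on constants can be recognized.\<close>

definition is_lin_form :: "'a set \<Rightarrow> real \<Rightarrow> (('a \<Rightarrow> real) \<Rightarrow> real) \<Rightarrow> bool" where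
  "is_lin_form A s L \<longleftrightarrow> (\<exists>v. sum v A = s \<and> (\<forall>f. L f = (\<Sum>x\<in>A. v x * f x)))"

lemma is_lin_form_eval: "finite A \<Longrightarrow> a \<in> A \<Longrightarrow> is_lin_form A 1 (\<lambda>f. f a)"
  unfolding is_lin_form_def
  by (rule exI[of _ "\<lambda>x. if x = a then 1 else 0"]) (simp add: mult_delta_left)

lemma is_lin_form_add:
  assumes "is_lin_form A s L" "is_lin_form A t M"
  shows "is_lin_form A (s + t) (\<lambda>f. L f + M f)"
proof -
  obtain v w where "sum v A = s" "\<And>f. L f = (\<Sum>x\<in>A. v x * f x)"
    "sum w A = t" "\<And>f. M f = (\<Sum>x\<in>A. w x * f x)"
    using assms unfolding is_lin_form_def by blast
  then show ?thesis unfolding is_lin_form_def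
    by (intro exI[of _ "\<lambda>x. v x + w x"]) (auto simp: sum.distrib distrib_right)
qed

lemma is_lin_form_scale:
  assumes "is_lin_form A s L"
  shows "is_lin_form A (k * s) (\<lambda>f. k * L f)"
proof -
  obtain v where "sum v A = s" "\<And>f. L f = (\<Sum>x\<in>A. v x * f x)"
    using assms unfolding is_lin_form_def by blast
  then show ?thesis unfolding is_lin_form_def
    by (intro exI[of _ "\<lambda>x. k * v x"]) (auto simp: sum_distrib_left mult.assoc)
qed

lemma is_lin_form_sum:
  assumes "finite I" "\<And>i. i \<in> I \<Longrightarrow> is_lin_form A (s i) (L i)"
  shows "is_lin_form A (\<Sum>i\<in>I. s i) (\<lambda>f. \<Sum>i\<in>I. L i f)"
  using assms
proof (induction I rule: finite_induct)
  case empty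
  then show ?case unfolding is_lin_form_def by (intro exI[of _ "\<lambda>_. 0"]) simp
next
  case (insert i I)
  then show ?case using is_lin_form_add[of A "s i" "L i" "sum s I" "\<lambda>f. \<Sum>i\<in>I. L i f"] by simp
qed

text \<open>Evaluation at indicators recovers the weights, so they need not be carried along
  explicitly.\<close>

lemma is_lin_form_coeff:
  assumes "finite A" "is_lin_form A s L"
  shows "(\<Sum>x\<in>A. L (indicator {x})) = s" "L f = (\<Sum>x\<in>A. L (indicator {x}) * f x)"
proof -
  obtain v where v: "sum v A = s" "\<And>f. L f = (\<Sum>x\<in>A. v x * f x)"
    using assms unfolding is_lin_form_def by blast
  have "L (indicator {x}) = v x" if "x \<in> A" for x
    using that \<open>finite A\<close> by (simp add: v(2) indicator_def if_distrib cong: if_cong)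
  then show "(\<Sum>x\<in>A. L (indicator {x})) = s" "L f = (\<Sum>x\<in>A. L (indicator {x}) * f x)"
    using v by simp_all
qed

text \<open>When the weights sum to 0, only the term with the negative sign survives in the variance
  identity, which gives the coefficients \<open>- (v x * v y)\<close>.\<close>

lemma is_diff_form_square:
  assumes "is_lin_form A 0 L"
  shows "is_diff_form A (\<lambda>f. (L f)\<^sup>2)"
proof -
  obtain v where v: "sum v A = 0" "\<And>f. L f = (\<Sum>x\<in>A. v x * f x)"
    using assms unfolding is_lin_form_def by blast
  define c where "c = (\<lambda>x y. if x \<in> A \<and> y \<in> A \<and> x \<noteq> y then - (v x * v y) else 0)"
  have "symmetric_on A c" by (auto simp: symmetric_on_def c_def)
  moreover have "(L f)\<^sup>2 = diff_form A c f" for f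
  proof -
    have "(\<Sum>x\<in>A. \<Sum>y\<in>A. c x y * (f x - f y)\<^sup>2) = - (\<Sum>x\<in>A. \<Sum>y\<in>A. v x * v y * (f x - f y)\<^sup>2)"
      unfolding sum_negf[symmetric] by (intro sum.cong refl) (simp add: c_def)
    then show ?thesis
      using sum_pair_weights[of v f A] by (simp add: diff_form_def v)
  qed
  ultimately show ?thesis unfolding is_diff_form_def by blast
qed

section \<open>The gasket\<close>

lemma less_3_iff: "(i::nat) < 3 \<longleftrightarrow> i = 0 \<or> i = 1 \<or> i = 2"
  by auto

lemma lessThan_3: "{..<3::nat} = {0, 1, 2}"
  by auto

lemma F_inject [simp]: "F q i x = F q i y \<longleftrightarrow> x = y"
  by (simp add: F_def)

lemma F_fixed [simp]: "F q i (q i) = q i"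
  by (simp add: F_def flip: scaleR_2)

lemma F_swap: "F q i (q j) = F q j (q i)"
  by (simp add: F_def add.commute)

lemma dist_F: "dist (F q i x) (F q i y) = dist x y / 2"
  by (simp add: F_def dist_norm flip: scaleR_diff_right)

lemma continuous_on_F [continuous_intros]: "continuous_on S g \<Longrightarrow> continuous_on S (\<lambda>x. F q i (g x))"
  unfolding F_def by (intro continuous_intros)

section \<open>Signed areas and barycentric coordinates\<close>

definition area :: "(nat \<Rightarrow> real^2) \<Rightarrow> real" where
  "area p = (p 1 - p 0)$1 * (p 2 - p 0)$2 - (p 1 - p 0)$2 * (p 2 - p 0)$1"

text \<open>Cramer's rule: \<open>area\<close> is twice the signed area of the triangle, and
  replacing vertex \<open>i\<close> by \<open>x\<close> gives the barycentric coordinate of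
  \<open>x\<close> as a ratio of areas.\<close>

definition bary :: "(nat \<Rightarrow> real^2) \<Rightarrow> nat \<Rightarrow> real^2 \<Rightarrow> real" where
  "bary q i x = area (q(i := x)) / area q"

lemma equilateral_area:
  assumes "equilateral q"
  shows "area q \<noteq> 0"
proof
  assume 0: "area q = 0"
  define a where "a = (q 1 - q 0)$1"
  define b where "b = (q 1 - q 0)$2"
  define c where "c = (q 2 - q 0)$1"
  define d where "d = (q 2 - q 0)$2"
  have 1: "a * d - b * c = 0" using 0 by (simp add: area_def a_def b_def c_def d_def)
  have n: "(dist x y)\<^sup>2 = (x$1 - y$1)\<^sup>2 + (x$2 - y$2)\<^sup>2" for x y :: "real^2"
    by (simp add: dist_norm norm_vec_def L2_set_def sum_2)
  have "(dist (q 0) (q 1))\<^sup>2 = (dist (q 1) (q 2))\<^sup>2" "(dist (q 1) (q 2))\<^sup>2 = (dist (q 2) (q 0))\<^sup>2"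
    using assms by (simp_all add: equilateral_def)
  then have 2: "a\<^sup>2 + b\<^sup>2 = (a - c)\<^sup>2 + (b - d)\<^sup>2" "(a - c)\<^sup>2 + (b - d)\<^sup>2 = c\<^sup>2 + d\<^sup>2"
    by (simp_all add: n a_def b_def c_def d_def power2_commute)
  \<comment> \<open>Lagrange's identity: for edge vectors of equal squared length \<open>l\<close>
    and inner product \<open>l / 2\<close>, the squared determinant is 3/4 of the square of
    \<open>l\<close>.\<close>
  have "3 * (a\<^sup>2 + b\<^sup>2)\<^sup>2 = 4 * (a * d - b * c)\<^sup>2" using 2 by algebra
  then have "a\<^sup>2 + b\<^sup>2 = 0" using 1 by simp
  then have "(q 1)$1 = (q 0)$1" "(q 1)$2 = (q 0)$2" by (simp_all add: a_def b_def sum_power2_eq_zero_iff)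
  then have "q 1 = q 0" by (simp add: vec_eq_iff forall_2)
  then show False using assms by (simp add: equilateral_def)
qed

section \<open>Inequalities and identities for one subdivision step\<close>

lemma subdivision_energy_ge:
  fixes a b c x y z :: real
  shows "(a - b)\<^sup>2 + (a - c)\<^sup>2 + (b - c)\<^sup>2 \<le>
    5/3 * (((a - x)\<^sup>2 + (a - y)\<^sup>2 + (x - y)\<^sup>2) + ((x - b)\<^sup>2 + (x - z)\<^sup>2 + (b - z)\<^sup>2)
          + ((y - z)\<^sup>2 + (y - c)\<^sup>2 + (z - c)\<^sup>2))"
proof -
  \<comment> \<open>the deviations from the harmonic values at the midpoints\<close>
  define x' y' z' where "x' = x - (2*a + 2*b + c)/5" "y' = y - (2*a + b + 2*c)/5" "z' = z - (a + 2*b + 2*c)/5"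
  have "5/3 * (((a - x)\<^sup>2 + (a - y)\<^sup>2 + (x - y)\<^sup>2) + ((x - b)\<^sup>2 + (x - z)\<^sup>2 + (b - z)\<^sup>2)
          + ((y - z)\<^sup>2 + (y - c)\<^sup>2 + (z - c)\<^sup>2)) - ((a - b)\<^sup>2 + (a - c)\<^sup>2 + (b - c)\<^sup>2) =
    5/3 * ((x' - y')\<^sup>2 + (x' - z')\<^sup>2 + (y' - z')\<^sup>2 + 2 * (x'\<^sup>2 + y'\<^sup>2 + z'\<^sup>2))"
    by (simp add: x'_y'_z'_def power2_eq_square field_simps)
  moreover have "\<dots> \<ge> 0" by simp
  ultimately show ?thesis by linarith
qed

text \<open>The minimum over \<open>x\<close> lies at the weighted mean, and its coefficient is the
  conductance of \<open>A\<close> and \<open>B\<close> in series.\<close>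

lemma complete_squares:
  fixes A B x p r :: real
  assumes "A + B \<noteq> 0"
  shows "A * (x - p)\<^sup>2 + B * (x - r)\<^sup>2 = A * B / (A + B) * (p - r)\<^sup>2 + (A + B) * (x - (A * p + B * r) / (A + B))\<^sup>2"
proof -
  define m where "m = (A * p + B * r) / (A + B)"
  have m: "(A + B) * m = A * p + B * r" using assms by (simp add: m_def)
  have "(A + B) * (A * B / (A + B) * (p - r)\<^sup>2) = A * B * (p - r)\<^sup>2" using assms by simp
  moreover have "(A + B) * (A * (x - p)\<^sup>2 + B * (x - r)\<^sup>2) = A * B * (p - r)\<^sup>2 + ((A + B) * x - (A + B) * m)\<^sup>2"
    unfolding m by (simp add: power2_eq_square algebra_simps)
  moreover have "((A + B) * x - (A + B) * m)\<^sup>2 = (A + B) * ((A + B) * (x - m)\<^sup>2)"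
    by (simp add: power2_eq_square algebra_simps)
  ultimately have "(A + B) * (A * (x - p)\<^sup>2 + B * (x - r)\<^sup>2) = (A + B) * (A * B / (A + B) * (p - r)\<^sup>2 + (A + B) * (x - m)\<^sup>2)"
    by (simp only: distrib_left[of "A + B" "A * B / (A + B) * (p - r)\<^sup>2"])
  then show ?thesis using assms by (simp add: m_def)
qed

text \<open>This is the energy of the top cell, with corner values \<open>t\<close>,
  \<open>y\<close>, \<open>z\<close>, together with two springs pulling \<open>y\<close> and
  \<open>z\<close> to the means of the lower cells. The mean and the difference of \<open>y\<close>
  and \<open>z\<close> decouple, and a square is completed in each.\<close>

lemma star_min:
  fixes al t y z m1 m2 :: real
  assumes "al > 0"
  shows "(t - y)\<^sup>2 + (t - z)\<^sup>2 + (y - z)\<^sup>2 + al * (y - m1)\<^sup>2 + al * (z - m2)\<^sup>2 =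
    2 * al / (1 + al) * (t - (m1 + m2) / 2)\<^sup>2 + 3 * al / (2 * (3 + al)) * (m1 - m2)\<^sup>2
    + 2 * (1 + al) * ((y + z) / 2 - (t + al * (m1 + m2) / 2) / (1 + al))\<^sup>2
    + (3 + al) / 2 * (y - z - al * (m1 - m2) / (3 + al))\<^sup>2"
proof -
  have "(t - y)\<^sup>2 + (t - z)\<^sup>2 + (y - z)\<^sup>2 + al * (y - m1)\<^sup>2 + al * (z - m2)\<^sup>2 =
    2 * (1 * ((y + z)/2 - t)\<^sup>2 + al * ((y + z)/2 - (m1 + m2)/2)\<^sup>2)
    + 1/2 * (3 * (y - z - 0)\<^sup>2 + al * (y - z - (m1 - m2))\<^sup>2)"
    by (simp add: power2_eq_square field_simps)
  also have "1 * ((y + z)/2 - t)\<^sup>2 + al * ((y + z)/2 - (m1 + m2)/2)\<^sup>2 =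
    al / (1 + al) * (t - (m1 + m2) / 2)\<^sup>2 + (1 + al) * ((y + z) / 2 - (t + al * (m1 + m2) / 2) / (1 + al))\<^sup>2"
    using assms complete_squares[of 1 al "(y + z)/2" t "(m1 + m2)/2"] by simp
  also have "3 * (y - z - 0)\<^sup>2 + al * (y - z - (m1 - m2))\<^sup>2 =
    3 * al / (3 + al) * (m1 - m2)\<^sup>2 + (3 + al) * (y - z - al * (m1 - m2) / (3 + al))\<^sup>2"
    using assms complete_squares[of 3 al "y - z" 0 "m1 - m2"] by (simp add: power2_commute[of m2 m1])
  also have "2 * (P * U + (1 + al) * W) + 1/2 * (3 * al / (3 + al) * D + (3 + al) * E) =
    2 * P * U + 3 * al / (2 * (3 + al)) * D + 2 * (1 + al) * W + (3 + al) / 2 * E" for P U W D E :: real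
    using assms by (simp add: field_simps)
  finally show ?thesis by simp
qed

text \<open>
  The recursions for \<open>alpha\<close> and \<open>row_energy\<close> are the minimum in \<open>star_min\<close> over \<open>y\<close> and \<open>z\<close>,
  multiplied by the energy scaling factor 5/3.
\<close>

primrec alpha :: "nat \<Rightarrow> real" where
  "alpha 0 = 2"
| "alpha (Suc n) = 10/3 * alpha n / (1 + alpha n)"

lemma alpha_pos: "alpha n > 0"
  by (induction n) simp_all

text \<open>Each of the \<open>2^n\<close> intervals contributes both of its ends, so the two
  corners count once and the inner points twice.\<close>

definition row_mean :: "(nat \<Rightarrow> real^2) \<Rightarrow> nat \<Rightarrow> (real^2 \<Rightarrow> real) \<Rightarrow> real" where
  "row_mean q n f = (\<Sum>i<2^n. f (bottom_pt q n i) + f (bottom_pt q n (Suc i))) / 2^(n+1)"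

primrec row_energy :: "(nat \<Rightarrow> real^2) \<Rightarrow> nat \<Rightarrow> (real^2 \<Rightarrow> real) \<Rightarrow> real" where
  "row_energy q 0 f = 3/2 * (f (q 1) - f (q 2))\<^sup>2"
| "row_energy q (Suc n) f = 5/3 * (row_energy q n (f \<circ> F q 1) + row_energy q n (f \<circ> F q 2)
     + 3 * alpha n / (2 * (3 + alpha n)) * (row_mean q n (f \<circ> F q 1) - row_mean q n (f \<circ> F q 2))\<^sup>2)"

lemma sum_lessThan_add:
  fixes g :: "nat \<Rightarrow> real"
  shows "(\<Sum>i<m + n. g i) = (\<Sum>i<m. g i) + (\<Sum>i<n. g (m + i))"
  by (induction n) simp_all

locale gasket =
  fixes q :: "nat \<Rightarrow> real^2"
  assumes equilateral: "equilateral q"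
begin

lemma area_nz: "area q \<noteq> 0"
  using equilateral by (rule equilateral_area)

lemma bary_vertex: "i < 3 \<Longrightarrow> j < 3 \<Longrightarrow> bary q i (q j) = (if i = j then 1 else 0)"
  using area_nz by (auto simp: less_3_iff bary_def area_def)

text \<open>The area is affine in each vertex, so barycentric coordinates are averaged along with
  the points.\<close>

lemma bary_F:
  assumes "i < 3" "j < 3"
  shows "bary q i (F q j x) = (bary q i x + (if i = j then 1 else 0)) / 2"
proof -
  have "area (q(i := F q j x)) = (area (q(i := x)) + area (q(i := q j))) / 2"
    using assms(1) by (auto simp: less_3_iff area_def F_def field_simps)
  then have "bary q i (F q j x) = (bary q i x + bary q i (q j)) / 2"
    using area_nz by (simp add: bary_def field_simps)
  then show ?thesis using bary_vertex assms by simp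
qed

lemma bary_sum: "bary q 0 x + bary q 1 x + bary q 2 x = 1"
proof -
  have "area (q(0 := x)) + area (q(1 := x)) + area (q(2 := x)) = area q"
    by (simp add: area_def algebra_simps)
  then show ?thesis using area_nz by (simp add: bary_def flip: add_divide_distrib)
qed

lemma bary_eqI:
  assumes "\<And>i. i < 3 \<Longrightarrow> bary q i x = bary q i y"
  shows "x = y"
proof -
  define a where "a = (q 1 - q 0)$1"
  define b where "b = (q 1 - q 0)$2"
  define c where "c = (q 2 - q 0)$1"
  define d where "d = (q 2 - q 0)$2"
  define r where "r = x$1 - y$1"
  define s where "s = x$2 - y$2"
  have nz: "a * d - b * c \<noteq> 0" using area_nz by (simp add: area_def a_def b_def c_def d_def)
  have "area (q(1 := x)) = area (q(1 := y))" "area (q(2 := x)) = area (q(2 := y))"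
    using assms[of 1] assms[of 2] area_nz by (simp_all add: bary_def)
  then have "r * d = s * c" "a * s = b * r"
    by (simp_all add: area_def a_def b_def c_def d_def r_def s_def algebra_simps)
  \<comment> \<open>The displacement \<open>(r, s)\<close> solves a homogeneous linear system whose
    determinant is the area.\<close>
  then have "r * (a * d - b * c) = 0" "s * (a * d - b * c) = 0" by algebra+
  then have "r = 0" "s = 0" using nz by simp_all
  then show ?thesis by (simp add: r_def s_def vec_eq_iff forall_2)
qed

lemma continuous_on_bary [continuous_intros]: "i < 3 \<Longrightarrow> continuous_on S (bary q i)"
proof -
  assume "i < 3"
  then have "continuous_on S (\<lambda>x. area (q(i := x)))"
    unfolding area_def by (auto simp: less_3_iff intro!: continuous_intros)
  then show ?thesis
    unfolding bary_def by (rule continuous_on_divide) (auto simp: area_nz)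
qed

section \<open>Existence and uniqueness of the attractor\<close>

lemma attractor_subset:
  assumes K: "compact K" "K = (\<Union>i<3. F q i ` K)" and L: "compact L" "L \<noteq> {}" "L = (\<Union>i<3. F q i ` L)"
  shows "K \<subseteq> L"
proof (cases "K = {}")
  case False
  \<comment> \<open>A point of \<open>K\<close> farthest from \<open>L\<close> is the image of a
    point of \<open>K\<close> under a map that halves distances and preserves \<open>L\<close>. The
    largest distance is thus at most half of itself, hence 0.\<close>
  have "continuous_on K (\<lambda>x. infdist x L)" by (intro continuous_intros)
  then obtain x where x: "x \<in> K" "\<And>y. y \<in> K \<Longrightarrow> infdist y L \<le> infdist x L"
    using continuous_attains_sup[OF K(1) False] by blast
  obtain i y where iy: "i < 3" "y \<in> K" "x = F q i y" using x(1) K(2) by blast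
  obtain z where z: "z \<in> L" "infdist y L = dist y z"
    using infdist_attains_inf[OF compact_imp_closed[OF L(1)] L(2)] by blast
  have "F q i z \<in> L" using z(1) iy(1) L(3) by blast
  then have "infdist x L \<le> dist y z / 2"
    using infdist_le[of "F q i z" L x] by (simp add: iy dist_F)
  with x(2)[OF iy(2)] z(2) have *: "infdist x L \<le> 0" by simp
  show ?thesis
  proof
    fix k assume "k \<in> K"
    then have "infdist k L = 0" using x(2)[of k] * infdist_nonneg[of k L] by linarith
    then show "k \<in> L" using in_closed_iff_infdist_zero[OF compact_imp_closed[OF L(1)] L(2)] by blast
  qed
qed simp

lemma attractor_exists: "\<exists>K. compact K \<and> K \<noteq> {} \<and> K = (\<Union>i<3. F q i ` K)"
proof -
  define R where "R = Max (norm ` q ` {..<3})"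
  have R: "norm (q i) \<le> R" if "i < 3" for i
    using that by (auto simp: R_def intro!: Max_ge)
  \<comment> \<open>A ball containing all vertices is mapped into itself, so its iterated images
    decrease; the attractor is their intersection.\<close>
  define B where "B = rec_nat (cball 0 R) (\<lambda>_ S. \<Union>i<3. F q i ` S)"
  have B0: "B 0 = cball 0 R" and BS: "B (Suc m) = (\<Union>i<3. F q i ` B m)" for m
    by (simp_all add: B_def)
  have F_ball: "F q i x \<in> cball 0 R" if "i < 3" "x \<in> cball 0 R" for i x
    using that R[of i] norm_triangle_ineq[of x "q i"] by (simp add: F_def)
  have dec: "B (Suc m) \<subseteq> B m" for m
  proof (induction m)
    case 0
    then show ?case unfolding BS B0 using F_ball by blast
  next
    case (Suc m)
    then have "(\<Union>i<3. F q i ` B (Suc m)) \<subseteq> (\<Union>i<3. F q i ` B m)" by blast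
    then show ?case by (simp only: BS)
  qed
  then have anti: "decseq B" by (rule decseq_SucI)
  have comp: "compact (B m)" for m
  proof (induction m)
    case 0
    show ?case by (simp add: B0)
  next
    case (Suc m)
    then show ?case unfolding BS
      by (intro compact_UN compact_continuous_image) (auto intro!: continuous_intros)
  qed
  define K where "K = (\<Inter>m. B m)"
  \<comment> \<open>The fixed point of \<open>F q 0\<close> survives in every iterate, so the
    intersection is nonempty.\<close>
  have "q 0 \<in> B m" for m
  proof (induction m)
    case 0
    show ?case using R[of 0] by (simp add: B0)
  next
    case (Suc m)
    have "F q 0 (q 0) \<in> B (Suc m)" unfolding BS using Suc by (intro UN_I[of 0] imageI) auto
    then show ?case by simp
  qed
  then have ne: "K \<noteq> {}" by (auto simp: K_def)
  have "closed K" unfolding K_def using comp by (intro closed_INT) (auto intro: compact_imp_closed)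
  then have "compact (B 0 \<inter> K)" using comp by (intro compact_Int_closed)
  moreover have "B 0 \<inter> K = K" by (auto simp: K_def)
  ultimately have "compact K" by simp
  moreover have "K = (\<Union>i<3. F q i ` K)"
  proof
    show "(\<Union>i<3. F q i ` K) \<subseteq> K"
    proof (clarsimp simp: K_def)
      fix i :: nat and x m assume "i < 3" "\<forall>m. x \<in> B m"
      then have "F q i x \<in> B (Suc m)" unfolding BS by blast
      then show "F q i x \<in> B m" using dec by blast
    qed
    show "K \<subseteq> (\<Union>i<3. F q i ` K)"
    proof
      fix x assume x: "x \<in> K"
      \<comment> \<open>One index serves all levels: if each of the three failed at some level, then
        by nestedness all would fail at the largest of these levels.\<close>
      have "\<exists>i<3. \<forall>m. x \<in> F q i ` B m"
      proof (rule ccontr)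
        assume "\<not> ?thesis"
        then have "\<forall>i. \<exists>m. i < 3 \<longrightarrow> x \<notin> F q i ` B m" by blast
        then obtain M where M: "\<And>i. i < 3 \<Longrightarrow> x \<notin> F q i ` B (M i)" using choice by metis
        define N where "N = Max (M ` {..<3})"
        have "x \<in> B (Suc N)" using x by (simp add: K_def)
        then obtain i where i: "i < 3" "x \<in> F q i ` B N" unfolding BS by blast
        have "M i \<le> N" using i by (auto simp: N_def)
        then have "B N \<subseteq> B (M i)" using anti by (simp add: decseq_def)
        with i M show False by blast
      qed
      then obtain i where i: "i < 3" "\<And>m. x \<in> F q i ` B m" by blast
      from i(2)[of 0] obtain y where y: "x = F q i y" by blast
      have "y \<in> B m" for m using i(2)[of m] y by auto
      then have "y \<in> K" by (simp add: K_def)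
      then show "x \<in> (\<Union>i<3. F q i ` K)" using i(1) y by blast
    qed
  qed
  ultimately show ?thesis using ne by (intro exI[of _ K] conjI)
qed

lemma SG_attractor: "compact (SG q) \<and> SG q \<noteq> {} \<and> SG q = (\<Union>i<3. F q i ` SG q)"
proof -
  have "\<exists>!K. compact K \<and> K \<noteq> {} \<and> K = (\<Union>i<3. F q i ` K)"
  proof (rule ex_ex1I[OF attractor_exists])
    fix K L assume "compact K \<and> K \<noteq> {} \<and> K = (\<Union>i<3. F q i ` K)" "compact L \<and> L \<noteq> {} \<and> L = (\<Union>i<3. F q i ` L)"
    then show "K = L" using attractor_subset[of K L] attractor_subset[of L K] by blast
  qed
  then show ?thesis unfolding SG_def by (rule theI')
qed

lemma compact_SG: "compact (SG q)" and SG_nonempty: "SG q \<noteq> {}" and SG_eq: "SG q = (\<Union>i<3. F q i ` SG q)"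
  using SG_attractor by blast+

lemma F_in_SG: "i < 3 \<Longrightarrow> x \<in> SG q \<Longrightarrow> F q i x \<in> SG q"
  using SG_eq by blast

lemma SG_cases:
  assumes "x \<in> SG q"
  obtains i y where "i < 3" "y \<in> SG q" "x = F q i y"
  using assms SG_eq by blast

text \<open>Applying \<open>F q i\<close> to a nearest point of the gasket halves its distance to
  the fixed point \<open>q i\<close> and stays in the gasket, so that distance is 0.\<close>

lemma vertex_in_SG:
  assumes "i < 3"
  shows "q i \<in> SG q"
proof -
  obtain z where z: "z \<in> SG q" "infdist (q i) (SG q) = dist (q i) z"
    using infdist_attains_inf[OF compact_imp_closed[OF compact_SG] SG_nonempty] by blast
  have "infdist (q i) (SG q) \<le> dist (F q i (q i)) (F q i z)"
    using infdist_le[OF F_in_SG[OF assms z(1)]] by simp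
  then have "dist (q i) z \<le> 0" by (simp add: dist_F z del: F_fixed)
  with z show ?thesis by simp
qed

text \<open>Minimum principle: \<open>F q j\<close> at most halves a coordinate and then adds
  something nonnegative, so the minimum is at least half of itself.\<close>

lemma bary_nonneg:
  assumes "i < 3" "x \<in> SG q"
  shows "bary q i x \<ge> 0"
proof -
  have "continuous_on (SG q) (bary q i)" using assms by (intro continuous_intros)
  then obtain z where z: "z \<in> SG q" "\<And>y. y \<in> SG q \<Longrightarrow> bary q i z \<le> bary q i y"
    using continuous_attains_inf[OF compact_SG SG_nonempty] by blast
  obtain j y where jy: "j < 3" "y \<in> SG q" "z = F q j y" using z(1) by (rule SG_cases)
  have "bary q i z \<ge> bary q i y / 2" using jy bary_F[OF assms(1) jy(1)] by simp
  with z(2)[OF jy(2)] z(2)[OF assms(2)] show ?thesis by simp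
qed

lemma bary_eq_1:
  assumes "i < 3" "x \<in> SG q" "bary q i x = 1"
  shows "x = q i"
proof (rule bary_eqI)
  fix j :: nat assume "j < 3"
  then show "bary q j x = bary q j (q i)"
    using assms bary_sum[of x] bary_nonneg[of 0 x] bary_nonneg[of 1 x] bary_nonneg[of 2 x]
    by (auto simp: bary_vertex less_3_iff)
qed

section \<open>Intersections of cells and gluing\<close>

lemma cells_meet:
  assumes "i < 3" "j < 3" "i \<noteq> j" "x \<in> SG q" "y \<in> SG q" "F q i x = F q j y"
  shows "x = q j" "y = q i"
proof -
  \<comment> \<open>Comparing coordinate \<open>k\<close> on both sides shows that the one of
    \<open>v\<close> exceeds the one of \<open>u\<close> by 1; as both lie between 0 and 1, the
    former is 1.\<close>
  have *: "v = q k" if "k < 3" "l < 3" "k \<noteq> l" "u \<in> SG q" "v \<in> SG q" "F q k u = F q l v" for k l u v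
  proof (rule bary_eq_1)
    have "bary q k u \<ge> 0" using that by (intro bary_nonneg)
    moreover have "bary q k v \<le> 1"
      using that bary_sum[of v] bary_nonneg[of 0 v] bary_nonneg[of 1 v] bary_nonneg[of 2 v]
      by (auto simp: less_3_iff)
    moreover have "bary q k u + 1 = bary q k v"
      using arg_cong[OF that(6), of "bary q k"] that bary_F[of k k u] bary_F[of k l v] by simp
    ultimately show "bary q k v = 1" by simp
  qed (use that in auto)
  show "y = q i" using *[of i j x y] assms by simp
  show "x = q j" using *[of j i y x] assms by simp
qed

lemma glue:
  assumes cont: "\<And>i. i < 3 \<Longrightarrow> continuous_on (SG q) (u i)"
    and match: "\<And>i j. i < 3 \<Longrightarrow> j < 3 \<Longrightarrow> u i (q j) = u j (q i)"
  obtains v where "continuous_on (SG q) v" "\<And>i x. i < 3 \<Longrightarrow> x \<in> SG q \<Longrightarrow> v (F q i x) = u i x"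
proof -
  \<comment> \<open>Any representation of \<open>z\<close> may be chosen: two of them in different
    cells describe a junction point, where \<open>match\<close> makes the values agree.\<close>
  define v where "v = (\<lambda>z. let p = SOME p. fst p < 3 \<and> snd p \<in> SG q \<and> z = F q (fst p) (snd p)
                              in u (fst p) (snd p))"
  have v: "v (F q i x) = u i x" if i: "i < 3" and x: "x \<in> SG q" for i x
  proof -
    define p where "p = (SOME p. fst p < 3 \<and> snd p \<in> SG q \<and> F q i x = F q (fst p) (snd p))"
    have p: "fst p < 3 \<and> snd p \<in> SG q \<and> F q i x = F q (fst p) (snd p)"
      unfolding p_def by (rule someI[of _ "(i, x)"]) (simp add: that)
    have "u (fst p) (snd p) = u i x"
    proof (cases "fst p = i")
      case True
      then show ?thesis using p by simp
    next
      case False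
      then show ?thesis using cells_meet[of i "fst p" x "snd p"] p i x match[of i "fst p"] by simp
    qed
    then show ?thesis by (simp add: v_def p_def[symmetric] Let_def)
  qed
  have "continuous_on (\<Union>i\<in>{..<3}. F q i ` SG q) v"
  proof (rule continuous_on_closed_Union)
    fix i :: nat assume "i \<in> {..<3}"
    then have i: "i < 3" by simp
    have "compact (F q i ` SG q)" 
      by (intro compact_continuous_image continuous_intros compact_SG)
    then show "closed (F q i ` SG q)" by (rule compact_imp_closed)
    have "continuous_on (F q i ` SG q) (\<lambda>z. u i (2 *\<^sub>R z - q i))"
    proof (rule continuous_on_compose2[OF cont[OF i]])
      show "(\<lambda>z. 2 *\<^sub>R z - q i) ` F q i ` SG q \<subseteq> SG q" by (auto simp: F_def)
    qed (intro continuous_intros)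
    moreover have "v z = u i (2 *\<^sub>R z - q i)" if "z \<in> F q i ` SG q" for z
      using that v[OF i] by (auto simp: F_def)
    ultimately show "continuous_on (F q i ` SG q) v" by (simp cong: continuous_on_cong)
  qed simp
  then have "continuous_on (SG q) v" using SG_eq by simp
  with v show thesis by (rule that[rotated])
qed

section \<open>Graph energies and their limit\<close>

lemma V_0: "V q 0 = {q 0, q 1, q 2}"
  by (simp add: lessThan_3)

lemma adj_in_SG:
  assumes "adj q m x y"
  shows "x \<in> SG q \<and> y \<in> SG q"
proof -
  have "Fword q w x \<in> SG q" if "set w \<subseteq> {..<3}" "x \<in> SG q" for w x
    using that by (induction w) (auto intro: F_in_SG)
  moreover have "V q 0 \<subseteq> SG q" unfolding V_0 using vertex_in_SG by simp
  ultimately show ?thesis using assms unfolding adj_def by blast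
qed

definition edges :: "nat \<Rightarrow> ((real^2) \<times> (real^2)) set" where
  "edges m = {(x, y). adj q m x y}"

lemma edges_0: "edges 0 = {q 0, q 1, q 2} \<times> {q 0, q 1, q 2} - Id"
  by (auto simp: edges_def adj_def lessThan_3)

lemma edges_Suc: "edges (Suc m) = (\<Union>i<3. map_prod (F q i) (F q i) ` edges m)"
proof (intro set_eqI iffI)
  fix e assume "e \<in> edges (Suc m)"
  then obtain x y where e: "e = (x, y)" "(x, y) \<in> edges (Suc m)" by (cases e) auto
  from e(2) obtain w where w: "x \<noteq> y" "length w = Suc m" "set w \<subseteq> {..<3}"
    "x \<in> Fword q w ` V q 0" "y \<in> Fword q w ` V q 0"
    unfolding edges_def adj_def by blast
  then obtain i w' where w': "w = i # w'" by (cases w) auto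
  from w w' obtain a b where ab: "a \<in> V q 0" "b \<in> V q 0" "x = F q i (Fword q w' a)" "y = F q i (Fword q w' b)"
    by auto
  have "(Fword q w' a, Fword q w' b) \<in> edges m"
    unfolding edges_def adj_def using w w' ab by (auto intro!: exI[of _ w'])
  then show "e \<in> (\<Union>i<3. map_prod (F q i) (F q i) ` edges m)"
    using w w' ab e by force
next
  fix e assume "e \<in> (\<Union>i<3. map_prod (F q i) (F q i) ` edges m)"
  then obtain i a b where i: "i < 3" "e = map_prod (F q i) (F q i) (a, b)" and "(a, b) \<in> edges m"
    by auto
  then obtain w where "a \<noteq> b" "length w = m" "set w \<subseteq> {..<3}"
    "a \<in> Fword q w ` V q 0" "b \<in> Fword q w ` V q 0"
    unfolding edges_def adj_def by blast
  with i show "e \<in> edges (Suc m)"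
    unfolding edges_def adj_def by (auto intro!: exI[of _ "i # w"] simp del: V.simps)
qed

lemma finite_edges: "finite (edges m)"
  by (induction m) (simp_all add: edges_0 edges_Suc)

lemma graph_energy_edges:
  "graph_energy q m u = (5/3)^m * ((\<Sum>e\<in>edges m. (u (fst e) - u (snd e))\<^sup>2) / 2)"
  by (simp add: graph_energy_def edges_def case_prod_unfold)

lemma graph_energy_cong:
  assumes "\<And>x. x \<in> SG q \<Longrightarrow> u x = v x"
  shows "graph_energy q m u = graph_energy q m v"
proof -
  have "(\<Sum>e\<in>edges m. (u (fst e) - u (snd e))\<^sup>2) = (\<Sum>e\<in>edges m. (v (fst e) - v (snd e))\<^sup>2)"
  proof (rule sum.cong)
    fix e assume "e \<in> edges m"
    then show "(u (fst e) - u (snd e))\<^sup>2 = (v (fst e) - v (snd e))\<^sup>2"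
      using assms adj_in_SG[of m "fst e" "snd e"] by (auto simp: edges_def)
  qed simp
  then show ?thesis by (simp add: graph_energy_edges)
qed

lemma vertices_distinct: "i < 3 \<Longrightarrow> j < 3 \<Longrightarrow> q i = q j \<Longrightarrow> i = j"
  using bary_vertex[of i i] bary_vertex[of i j] by (auto split: if_splits)

lemma graph_energy_0: "graph_energy q 0 u = (u (q 0) - u (q 1))\<^sup>2 + (u (q 0) - u (q 2))\<^sup>2 + (u (q 1) - u (q 2))\<^sup>2"
proof -
  have ne: "q 0 \<noteq> q 1" "q 0 \<noteq> q 2" "q 1 \<noteq> q 2"
    using vertices_distinct[of 0 1] vertices_distinct[of 0 2] vertices_distinct[of 1 2] by auto
  have "edges 0 = {(q 0, q 1), (q 0, q 2), (q 1, q 0), (q 1, q 2), (q 2, q 0), (q 2, q 1)}"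
    unfolding edges_0 using ne by auto
  then show ?thesis using ne ne[symmetric]
    by (simp add: graph_energy_edges power2_commute del: One_nat_def)
qed

text \<open>Edges in different cells are different: two cells share at most one point, while an edge
  has two distinct ends. The energy therefore splits over the cells.\<close>

lemma graph_energy_Suc:
  "graph_energy q (Suc m) u =
    5/3 * (graph_energy q m (u \<circ> F q 0) + graph_energy q m (u \<circ> F q 1) + graph_energy q m (u \<circ> F q 2))"
proof -
  let ?f = "\<lambda>i. map_prod (F q i) (F q i)"
  have disj: "?f i ` edges m \<inter> ?f j ` edges m = {}" if "i < 3" "j < 3" "i \<noteq> j" for i j
  proof (rule ccontr)
    assume "\<not> ?thesis"
    then obtain a b c d where *: "adj q m a b" "adj q m c d" "F q i a = F q j c" "F q i b = F q j d"
      unfolding edges_def by auto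
    then have "a = q j" "b = q j"
      using cells_meet[of i j a c] cells_meet[of i j b d] that adj_in_SG by auto
    then show False using * by (simp add: adj_def)
  qed
  have inj: "inj_on (?f i) A" for i A by (auto simp: inj_on_def)
  have "(\<Sum>e\<in>edges (Suc m). (u (fst e) - u (snd e))\<^sup>2) =
    (\<Sum>i<3. \<Sum>e\<in>?f i ` edges m. (u (fst e) - u (snd e))\<^sup>2)"
    unfolding edges_Suc by (rule sum.UNION_disjoint) (use finite_edges disj in auto)
  also have "\<dots> = (\<Sum>i<3. \<Sum>e\<in>edges m. ((u \<circ> F q i) (fst e) - (u \<circ> F q i) (snd e))\<^sup>2)"
    by (simp add: sum.reindex[OF inj])
  finally show ?thesis
    by (simp add: graph_energy_edges lessThan_3 algebra_simps add_divide_distrib)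
qed

text \<open>The single triangle is handled by \<open>subdivision_energy_ge\<close>, and
  self-similarity passes the inequality to all levels.\<close>

lemma graph_energy_step: "graph_energy q m u \<le> graph_energy q (Suc m) u"
proof (induction m arbitrary: u)
  case 0
  show ?case
    unfolding graph_energy_Suc graph_energy_0 comp_apply F_fixed F_swap[of q 1 0] F_swap[of q 2 0] F_swap[of q 2 1]
    by (rule subdivision_energy_ge)
next
  case (Suc m)
  show ?case
    unfolding graph_energy_Suc[of "Suc m"] using Suc[of "u \<circ> F q 0"] Suc[of "u \<circ> F q 1"] Suc[of "u \<circ> F q 2"]
    by (subst graph_energy_Suc) argo
qed

lemma graph_energy_mono: "m \<le> n \<Longrightarrow> graph_energy q m u \<le> graph_energy q n u"
  by (rule lift_Suc_mono_le[of "\<lambda>m. graph_energy q m u", OF graph_energy_step])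

lemma energy_SUP: "energy q u = (SUP m. ereal (graph_energy q m u))"
  unfolding energy_def
  by (intro limI LIMSEQ_SUP incseq_SucI) (simp add: graph_energy_step)

lemma graph_energy_le_energy: "ereal (graph_energy q m u) \<le> energy q u"
  unfolding energy_SUP by (rule SUP_upper) simp

lemma energy_eqI:
  assumes "\<And>m. m \<ge> n \<Longrightarrow> graph_energy q m u = E"
  shows "energy q u = ereal E"
proof (rule antisym)
  show "energy q u \<le> ereal E"
    unfolding energy_SUP
  proof (rule SUP_least)
    fix m
    show "ereal (graph_energy q m u) \<le> ereal E"
      using graph_energy_mono[of m "max m n" u] assms[of "max m n"] by simp
  qed
  show "ereal E \<le> energy q u"
    using graph_energy_le_energy[of n u] assms[of n] by simp
qed

section \<open>Harmonic functions\<close>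

text \<open>
  \<open>hstep i a\<close> gives the vertex values on the cell \<open>F i\<close> of the harmonic function with vertex values
  \<open>a\<close> (the 2/5, 2/5, 1/5 rule). It contracts the oscillation of \<open>a\<close> by 3/5, so \<open>hseq\<close> converges uniformly.
\<close>

definition hstep :: "nat \<Rightarrow> (nat \<Rightarrow> real) \<Rightarrow> nat \<Rightarrow> real" where
  "hstep i a j = (if i = j then a i else (a i + a j + a 0 + a 1 + a 2) / 5)"

primrec hseq :: "nat \<Rightarrow> (nat \<Rightarrow> real) \<Rightarrow> real^2 \<Rightarrow> real" where
  "hseq 0 a = (\<lambda>x. \<Sum>i<3. a i * bary q i x)"
| "hseq (Suc m) a = (SOME v. continuous_on (SG q) v \<and> (\<forall>i<3. \<forall>x\<in>SG q. v (F q i x) = hseq m (hstep i a) x))"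

text \<open>The choice in \<open>hseq\<close> is legitimate by \<open>glue\<close>:
  \<open>hstep i a j\<close> is symmetric in \<open>i\<close> and \<open>j\<close>, so the pieces
  agree at junction points. The induction must carry the vertex values because this matching uses
  them.\<close>

lemma hseq_props:
  "continuous_on (SG q) (hseq m a) \<and> (\<forall>j<3. hseq m a (q j) = a j) \<and>
   (\<forall>i<3. \<forall>x\<in>SG q. hseq (Suc m) a (F q i x) = hseq m (hstep i a) x)"
proof -
  have step: "continuous_on (SG q) (hseq (Suc m) a) \<and>
      (\<forall>i<3. \<forall>x\<in>SG q. hseq (Suc m) a (F q i x) = hseq m (hstep i a) x)"
    if P: "\<And>a. continuous_on (SG q) (hseq m a) \<and> (\<forall>j<3. hseq m a (q j) = a j)" for m a
  proof -
    have "\<exists>v. continuous_on (SG q) v \<and> (\<forall>i<3. \<forall>x\<in>SG q. v (F q i x) = hseq m (hstep i a) x)"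
    proof (rule glue[of "\<lambda>i. hseq m (hstep i a)"])
      show "hseq m (hstep i a) (q j) = hseq m (hstep j a) (q i)" if "i < 3" "j < 3" for i j
        using that P by (simp add: hstep_def)
    qed (use P in auto)
    then show ?thesis unfolding hseq.simps(2) by (rule someI_ex)
  qed
  have base: "continuous_on (SG q) (hseq m a) \<and> (\<forall>j<3. hseq m a (q j) = a j)" for m a
  proof (induction m arbitrary: a)
    case 0
    show ?case by (auto simp: lessThan_3 less_3_iff bary_vertex intro!: continuous_intros)
  next
    case (Suc m)
    have "hseq (Suc m) a (q j) = a j" if "j < 3" for j
      using step[OF Suc, of a] that vertex_in_SG[OF that] Suc[of "hstep j a"] F_fixed[of q j]
      by (metis hstep_def)
    then show ?case using step[OF Suc, of a] by blast
  qed
  show ?thesis using base step[OF base] by blast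
qed

lemma hseq_F: "i < 3 \<Longrightarrow> x \<in> SG q \<Longrightarrow> hseq (Suc m) a (F q i x) = hseq m (hstep i a) x"
  using hseq_props by blast

text \<open>At least 2/5 of the weight sits on \<open>a i\<close>, so all values on cell
  \<open>i\<close> lie in a common interval of length \<open>3/5 * (hi - lo)\<close>.\<close>

lemma hstep_range:
  assumes "i < 3" "j < 3" "\<And>k. k < 3 \<Longrightarrow> lo \<le> a k \<and> a k \<le> hi"
  shows "2/5 * a i + 3/5 * lo \<le> hstep i a j \<and> hstep i a j \<le> 2/5 * a i + 3/5 * hi"
  using assms(1,2) assms(3)[of 0] assms(3)[of 1] assms(3)[of 2]
  by (auto simp: hstep_def less_3_iff)

lemma hseq_range:
  assumes "x \<in> SG q" "\<And>k. k < 3 \<Longrightarrow> lo \<le> a k \<and> a k \<le> hi"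
  shows "lo \<le> hseq m a x \<and> hseq m a x \<le> hi"
  using assms
proof (induction m arbitrary: a x)
  case 0
  have nn: "bary q k x \<ge> 0" if "k < 3" for k using bary_nonneg that 0 by blast
  have l: "lo * bary q k x \<le> a k * bary q k x" "a k * bary q k x \<le> hi * bary q k x" if "k < 3" for k
    using 0 that nn[OF that] by (auto intro: mult_right_mono)
  have "lo * (bary q 0 x + bary q 1 x + bary q 2 x) \<le> hseq 0 a x"
    using l(1)[of 0] l(1)[of 1] l(1)[of 2] by (simp add: lessThan_3 distrib_left)
  moreover have "hseq 0 a x \<le> hi * (bary q 0 x + bary q 1 x + bary q 2 x)"
    using l(2)[of 0] l(2)[of 1] l(2)[of 2] by (simp add: lessThan_3 distrib_left)
  ultimately show ?case by (simp only: bary_sum mult_1_right simp_thms)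
next
  case (Suc m)
  obtain i y where iy: "i < 3" "y \<in> SG q" "x = F q i y" using Suc.prems(1) by (rule SG_cases)
  have "lo \<le> hstep i a k \<and> hstep i a k \<le> hi" if "k < 3" for k
    using hstep_range[OF iy(1) that, of lo a hi] Suc.prems(2) Suc.prems(2)[OF iy(1)] by force
  then show ?case using Suc.IH[OF iy(2)] hseq_F[OF iy(1,2)] iy(3) by simp
qed

text \<open>Each descent into a cell shrinks the range of vertex values by 3/5; after
  \<open>m\<close> descents both approximants lie in the same range. The bounds therefore vary in
  the induction.\<close>

lemma hseq_Cauchy:
  assumes "x \<in> SG q" "\<And>k. k < 3 \<Longrightarrow> lo \<le> a k \<and> a k \<le> hi"
  shows "\<bar>hseq (m + n) a x - hseq m a x\<bar> \<le> (3/5)^m * (hi - lo)"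
  using assms
proof (induction m arbitrary: a x lo hi)
  case 0
  then show ?case using hseq_range[of x lo a hi n] hseq_range[of x lo a hi 0] by (simp add: abs_le_iff)
next
  case (Suc m)
  obtain i y where iy: "i < 3" "y \<in> SG q" "x = F q i y" using Suc.prems(1) by (rule SG_cases)
  have "2/5 * a i + 3/5 * lo \<le> hstep i a k \<and> hstep i a k \<le> 2/5 * a i + 3/5 * hi" if "k < 3" for k
    using hstep_range[OF iy(1) that] Suc.prems(2) by blast
  note Suc.IH[OF iy(2) this]
  also have "(3/5)^m * ((2/5 * a i + 3/5 * hi) - (2/5 * a i + 3/5 * lo)) = (3/5)^Suc m * (hi - lo)"
    by (simp add: algebra_simps)
  finally show ?case using hseq_F[OF iy(1,2)] iy(3) by simp
qed

text \<open>The uniform limit of \<open>hseq\<close> obeys the extension rule exactly, and for this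
  rule the factor 5/3 makes the energy the same at every level.\<close>

lemma harmonic_exists:
  obtains h where "continuous_on (SG q) h" "\<And>j. j < 3 \<Longrightarrow> h (q j) = a j"
    "\<And>m. graph_energy q m h = (a 0 - a 1)\<^sup>2 + (a 0 - a 2)\<^sup>2 + (a 1 - a 2)\<^sup>2"
proof -
  have ucauchy: "uniformly_Cauchy_on (SG q) (\<lambda>m. hseq m a)" for a
    unfolding uniformly_Cauchy_on_def
  proof (intro allI impI)
    fix e :: real assume e: "e > 0"
    define C where "C = \<bar>a 0\<bar> + \<bar>a 1\<bar> + \<bar>a 2\<bar>"
    have C: "-C \<le> a k \<and> a k \<le> C" if "k < 3" for k using that by (auto simp: C_def less_3_iff)
    have "(\<lambda>m. (3/5)^m * (C - (-C))) \<longlonglongrightarrow> 0"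
      by (intro tendsto_mult_left_zero LIMSEQ_power_zero) simp
    then have "eventually (\<lambda>m. (3/5)^m * (C - (-C)) < e/2) sequentially"
      using e by (intro order_tendstoD) auto
    then obtain M where M: "(3/5)^M * (C - (-C)) < e/2" by (auto simp: eventually_sequentially)
    have "dist (hseq m a x) (hseq n a x) < e" if "x \<in> SG q" "m \<ge> M" "n \<ge> M" for x m n
      using hseq_Cauchy[of x "-C" a C M "m - M", OF that(1) C] hseq_Cauchy[of x "-C" a C M "n - M", OF that(1) C] that M
      by (simp add: dist_real_def)
    then show "\<exists>M. \<forall>x\<in>SG q. \<forall>m\<ge>M. \<forall>n\<ge>M. dist (hseq m a x) (hseq n a x) < e" by blast
  qed
  then have "\<forall>a. \<exists>h. uniform_limit (SG q) (\<lambda>m. hseq m a) h sequentially"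
    using Cauchy_uniformly_convergent unfolding uniformly_convergent_on_def by blast
  then obtain h where h: "\<And>a. uniform_limit (SG q) (\<lambda>m. hseq m a) (h a) sequentially" by metis
  have lim: "(\<lambda>m. hseq m a x) \<longlonglongrightarrow> h a x" if "x \<in> SG q" for a x
    using tendsto_uniform_limitI[OF h that] .
  \<comment> \<open>Both sides are limits of the same sequence, by the recursion for
    \<open>hseq\<close>.\<close>
  have hF: "h a (F q i x) = h (hstep i a) x" if "i < 3" "x \<in> SG q" for a i x
  proof (rule LIMSEQ_unique)
    show "(\<lambda>m. hseq (Suc m) a (F q i x)) \<longlonglongrightarrow> h a (F q i x)"
      using lim[OF F_in_SG[OF that]] by (rule LIMSEQ_Suc)
    show "(\<lambda>m. hseq (Suc m) a (F q i x)) \<longlonglongrightarrow> h (hstep i a) x"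
      using lim[OF that(2)] hseq_F[OF that] by simp
  qed
  have hv: "h a (q j) = a j" if "j < 3" for a j
    using lim[OF vertex_in_SG[OF that], of a] hseq_props that by (simp add: LIMSEQ_const_iff)
  have "graph_energy q m (h a) = (a 0 - a 1)\<^sup>2 + (a 0 - a 2)\<^sup>2 + (a 1 - a 2)\<^sup>2" for m a
  proof (induction m arbitrary: a)
    case 0
    show ?case unfolding graph_energy_0 using hv[of 0 a] hv[of 1 a] hv[of 2 a] by simp
  next
    case (Suc m)
    have "graph_energy q m (h a \<circ> F q i) = graph_energy q m (h (hstep i a))" if "i < 3" for i
      by (rule graph_energy_cong) (simp add: hF that)
    then have "graph_energy q (Suc m) (h a) =
      5/3 * (graph_energy q m (h (hstep 0 a)) + graph_energy q m (h (hstep 1 a)) + graph_energy q m (h (hstep 2 a)))"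
      by (simp add: graph_energy_Suc)
    then show ?case by (simp add: Suc hstep_def power2_eq_square field_simps)
  qed
  moreover have "continuous_on (SG q) (h a)"
    by (rule uniform_limit_theorem[OF _ h]) (simp_all add: hseq_props)
  ultimately show thesis using that hv by blast
qed

section \<open>Minimal energy for prescribed values on the bottom row and the top\<close>

lemma bottom_pt_F1: "F q 1 (bottom_pt q n i) = bottom_pt q (Suc n) i"
  by (simp add: F_def bottom_pt_def vec_eq_iff field_simps)

lemma bottom_pt_F2: "F q 2 (bottom_pt q n i) = bottom_pt q (Suc n) (2^n + i)"
  by (simp add: F_def bottom_pt_def vec_eq_iff field_simps)

lemma bottom_row_0: "bottom_row q 0 = {q 1, q 2}"
proof -
  have "{0..2^0} = {0, 1::nat}" by auto
  then show ?thesis by (simp add: bottom_row_def bottom_pt_def)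
qed

lemma bottom_row_Suc: "bottom_row q (Suc n) = F q 1 ` bottom_row q n \<union> F q 2 ` bottom_row q n"
proof -
  \<comment> \<open>The two halves overlap in the index \<open>2^n\<close>, the midpoint of the
    row.\<close>
  have "{0..2^Suc n} = {0..2^n} \<union> (+) (2^n) ` {0..2^n::nat}"
    by (auto simp: image_add_atLeastAtMost)
  then show ?thesis
    by (simp only: bottom_row_def image_Un image_image bottom_pt_F1 bottom_pt_F2)
qed

lemma corners_in_bottom_row: "q 1 \<in> bottom_row q n" "q 2 \<in> bottom_row q n"
proof -
  have "bottom_pt q n 0 = q 1" "bottom_pt q n (2^n) = q 2" by (simp_all add: bottom_pt_def)
  then show "q 1 \<in> bottom_row q n" "q 2 \<in> bottom_row q n"
    unfolding bottom_row_def by (metis atLeastAtMost_iff imageI le0 order_refl)+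
qed

lemma row_mean_Suc: "row_mean q (Suc n) f = (row_mean q n (f \<circ> F q 1) + row_mean q n (f \<circ> F q 2)) / 2"
proof -
  have "(\<Sum>i<2^Suc n. g i) = (\<Sum>i<2^n. g i) + (\<Sum>i<2^n. g (2^n + i))" for g :: "nat \<Rightarrow> real"
    using sum_lessThan_add[of g "2^n" "2^n"] by (simp add: mult_2)
  then show ?thesis
    by (simp add: row_mean_def bottom_pt_F1 bottom_pt_F2 field_simps flip: One_nat_def)
qed

section \<open>The least energy: formula, lower bound and attainment\<close>

definition cell_energy :: "nat \<Rightarrow> real \<Rightarrow> (real^2 \<Rightarrow> real) \<Rightarrow> real" where
  "cell_energy n t f = alpha n * (t - row_mean q n f)\<^sup>2 + row_energy q n f"

text \<open>Completing the square in \<open>t\<close> explains the initial values: 2 in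
  \<open>alpha\<close> and 3/2 in \<open>row_energy\<close>.\<close>

lemma cell_energy_0: "cell_energy 0 t f = (t - f (q 1))\<^sup>2 + (t - f (q 2))\<^sup>2 + (f (q 1) - f (q 2))\<^sup>2"
  by (simp add: cell_energy_def row_mean_def bottom_pt_def lessThan_Suc power2_eq_square field_simps)

text \<open>Here \<open>y\<close> and \<open>z\<close> are the values at the tops of the two lower
  cells. Writing the excess as explicit squares serves twice: dropping them gives the lower bound,
  and making them vanish gives the minimizer.\<close>

lemma cell_energy_Suc:
  "\<exists>s d. \<forall>y z. 5/3 * ((t - y)\<^sup>2 + (t - z)\<^sup>2 + (y - z)\<^sup>2 + cell_energy n y (f \<circ> F q 1) + cell_energy n z (f \<circ> F q 2)) =
    cell_energy (Suc n) t f + 10/3 * (1 + alpha n) * ((y + z) / 2 - s)\<^sup>2 + 5/6 * (3 + alpha n) * (y - z - d)\<^sup>2"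
proof -
  define al m1 m2 where "al = alpha n" "m1 = row_mean q n (f \<circ> F q 1)" "m2 = row_mean q n (f \<circ> F q 2)"
  define s d where "s = (t + al * (m1 + m2) / 2) / (1 + al)" "d = al * (m1 - m2) / (3 + al)"
  have "al > 0" by (simp add: al_m1_m2_def alpha_pos)
  have "5/3 * ((t - y)\<^sup>2 + (t - z)\<^sup>2 + (y - z)\<^sup>2 + cell_energy n y (f \<circ> F q 1) + cell_energy n z (f \<circ> F q 2)) =
    cell_energy (Suc n) t f + 10/3 * (1 + al) * ((y + z) / 2 - s)\<^sup>2 + 5/6 * (3 + al) * (y - z - d)\<^sup>2" for y z
  proof -
    have "5/3 * ((t - y)\<^sup>2 + (t - z)\<^sup>2 + (y - z)\<^sup>2 + cell_energy n y (f \<circ> F q 1) + cell_energy n z (f \<circ> F q 2)) =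
      5/3 * ((t - y)\<^sup>2 + (t - z)\<^sup>2 + (y - z)\<^sup>2 + al * (y - m1)\<^sup>2 + al * (z - m2)\<^sup>2)
      + 5/3 * (row_energy q n (f \<circ> F q 1) + row_energy q n (f \<circ> F q 2))"
      by (simp add: cell_energy_def al_m1_m2_def distrib_left add_divide_distrib del: One_nat_def)
    also have "(t - y)\<^sup>2 + (t - z)\<^sup>2 + (y - z)\<^sup>2 + al * (y - m1)\<^sup>2 + al * (z - m2)\<^sup>2 =
      2 * al / (1 + al) * (t - (m1 + m2) / 2)\<^sup>2 + 3 * al / (2 * (3 + al)) * (m1 - m2)\<^sup>2
      + 2 * (1 + al) * ((y + z) / 2 - s)\<^sup>2 + (3 + al) / 2 * (y - z - d)\<^sup>2"
      unfolding s_d_def using \<open>al > 0\<close> by (rule star_min)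
    also have "5/3 * (2 * al / (1 + al) * (t - (m1 + m2) / 2)\<^sup>2 + 3 * al / (2 * (3 + al)) * (m1 - m2)\<^sup>2
      + 2 * (1 + al) * ((y + z) / 2 - s)\<^sup>2 + (3 + al) / 2 * (y - z - d)\<^sup>2)
      + 5/3 * (row_energy q n (f \<circ> F q 1) + row_energy q n (f \<circ> F q 2)) =
      (10/3 * al / (1 + al) * (t - (m1 + m2) / 2)\<^sup>2 + 5/3 * (row_energy q n (f \<circ> F q 1) + row_energy q n (f \<circ> F q 2)
        + 3 * al / (2 * (3 + al)) * (m1 - m2)\<^sup>2))
      + 10/3 * (1 + al) * ((y + z) / 2 - s)\<^sup>2 + 5/6 * (3 + al) * (y - z - d)\<^sup>2"
    proof -
      have "10/3 * al / (1 + al) = 5/3 * (2 * al / (1 + al))" "10/3 * (1 + al) = 5/3 * (2 * (1 + al))"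
        "5/6 * (3 + al) = 5/3 * ((3 + al) / 2)" by simp_all
      then show ?thesis by (simp only: distrib_left[of "5/3"] mult.assoc ac_simps)
    qed
    also have "10/3 * al / (1 + al) * (t - (m1 + m2) / 2)\<^sup>2 + 5/3 * (row_energy q n (f \<circ> F q 1) + row_energy q n (f \<circ> F q 2)
        + 3 * al / (2 * (3 + al)) * (m1 - m2)\<^sup>2) = cell_energy (Suc n) t f"
      by (simp add: cell_energy_def row_mean_Suc al_m1_m2_def del: One_nat_def)
    finally show ?thesis .
  qed
  then show ?thesis unfolding al_m1_m2_def by blast
qed

text \<open>In the inductive step the top cell has at least the energy of its corner values, by
  monotonicity in the level, and the lower cells satisfy the induction hypothesis.\<close>

lemma graph_energy_ge_cell_energy: "cell_energy n (u (q 0)) u \<le> graph_energy q n u"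
proof (induction n arbitrary: u)
  case 0
  show ?case by (simp add: cell_energy_0 graph_energy_0)
next
  case (Suc n)
  define y where "y = u (F q 0 (q 1))"
  define z where "z = u (F q 0 (q 2))"
  have 0: "graph_energy q n (u \<circ> F q 0) \<ge> (u (q 0) - y)\<^sup>2 + (u (q 0) - z)\<^sup>2 + (y - z)\<^sup>2"
    using graph_energy_mono[of 0 n "u \<circ> F q 0"] by (simp add: graph_energy_0 y_def z_def)
  have 1: "graph_energy q n (u \<circ> F q 1) \<ge> cell_energy n y (u \<circ> F q 1)"
    using Suc[of "u \<circ> F q 1"] F_swap[of q 0 1] by (simp add: y_def comp_def)
  have 2: "graph_energy q n (u \<circ> F q 2) \<ge> cell_energy n z (u \<circ> F q 2)"
    using Suc[of "u \<circ> F q 2"] F_swap[of q 0 2] by (simp add: z_def comp_def)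
  obtain s d where sd: "5/3 * ((u (q 0) - y)\<^sup>2 + (u (q 0) - z)\<^sup>2 + (y - z)\<^sup>2 + cell_energy n y (u \<circ> F q 1) + cell_energy n z (u \<circ> F q 2)) =
    cell_energy (Suc n) (u (q 0)) u + 10/3 * (1 + alpha n) * ((y + z) / 2 - s)\<^sup>2 + 5/6 * (3 + alpha n) * (y - z - d)\<^sup>2"
    using cell_energy_Suc by blast
  have "10/3 * (1 + alpha n) * ((y + z) / 2 - s)\<^sup>2 \<ge> 0" "5/6 * (3 + alpha n) * (y - z - d)\<^sup>2 \<ge> 0"
    using alpha_pos[of n] by simp_all
  then show ?case using 0 1 2 sd unfolding graph_energy_Suc by argo
qed

text \<open>A harmonic function on the top cell is glued to minimizers on the two lower cells.
  Constancy of the energy from level \<open>n\<close> on makes it the energy of the limit as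
  well.\<close>

lemma cell_energy_attained:
  "\<exists>u. continuous_on (SG q) u \<and> u (q 0) = t \<and> (\<forall>x\<in>bottom_row q n. u x = f x) \<and>
    (\<forall>m\<ge>n. graph_energy q m u = cell_energy n t f)"
proof (induction n arbitrary: t f)
  case 0
  obtain h where h: "continuous_on (SG q) h" "\<And>j. j < 3 \<Longrightarrow> h (q j) = (if j = 0 then t else f (q j))"
    "\<And>m. graph_energy q m h = (t - f (q 1))\<^sup>2 + (t - f (q 2))\<^sup>2 + (f (q 1) - f (q 2))\<^sup>2"
    by (rule harmonic_exists[of "\<lambda>j. if j = 0 then t else f (q j)"]) simp
  then show ?case by (intro exI[of _ h]) (simp add: bottom_row_0 cell_energy_0 del: One_nat_def)
next
  case (Suc n)
  obtain s d where sd: "\<And>y z. 5/3 * ((t - y)\<^sup>2 + (t - z)\<^sup>2 + (y - z)\<^sup>2 + cell_energy n y (f \<circ> F q 1) + cell_energy n z (f \<circ> F q 2)) =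
    cell_energy (Suc n) t f + 10/3 * (1 + alpha n) * ((y + z) / 2 - s)\<^sup>2 + 5/6 * (3 + alpha n) * (y - z - d)\<^sup>2"
    using cell_energy_Suc[of t n f] by blast
  \<comment> \<open>These values have mean \<open>s\<close> and difference \<open>d\<close>, so both
    excess squares vanish.\<close>
  define y where "y = s + d/2"
  define z where "z = s - d/2"
  obtain u0 where u0: "continuous_on (SG q) u0" "\<And>j. j < 3 \<Longrightarrow> u0 (q j) = (if j = 0 then t else if j = 1 then y else z)"
    "\<And>m. graph_energy q m u0 = (t - y)\<^sup>2 + (t - z)\<^sup>2 + (y - z)\<^sup>2"
    by (rule harmonic_exists[of "\<lambda>j. if j = 0 then t else if j = 1 then y else z"]) simp
  obtain u1 where u1: "continuous_on (SG q) u1" "u1 (q 0) = y" "\<And>x. x \<in> bottom_row q n \<Longrightarrow> u1 x = f (F q 1 x)"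
    "\<And>m. m \<ge> n \<Longrightarrow> graph_energy q m u1 = cell_energy n y (f \<circ> F q 1)"
    using Suc[of y "f \<circ> F q 1"] by (auto simp: comp_def)
  obtain u2 where u2: "continuous_on (SG q) u2" "u2 (q 0) = z" "\<And>x. x \<in> bottom_row q n \<Longrightarrow> u2 x = f (F q 2 x)"
    "\<And>m. m \<ge> n \<Longrightarrow> graph_energy q m u2 = cell_energy n z (f \<circ> F q 2)"
    using Suc[of z "f \<circ> F q 2"] by (auto simp: comp_def)
  define w where "w = (\<lambda>i::nat. if i = 0 then u0 else if i = 1 then u1 else u2)"
  have w: "w 0 = u0" "w 1 = u1" "w 2 = u2" by (simp_all add: w_def)
  have "continuous_on (SG q) (w i)" if "i < 3" for i
    using that u0 u1 u2 by (simp add: w_def)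
  moreover have "w i (q j) = w j (q i)" if "i < 3" "j < 3" for i j
  proof -
    \<comment> \<open>The lower cells meet in a point of the bottom row, where both minimizers take
      the value of \<open>f\<close>.\<close>
    have "u1 (q 2) = u2 (q 1)"
      using u1(3)[OF corners_in_bottom_row(2)] u2(3)[OF corners_in_bottom_row(1)] F_swap[of q 1 2] by simp
    moreover have "u0 (q 1) = y" "u0 (q 2) = z" using u0(2)[of 1] u0(2)[of 2] by simp_all
    ultimately show ?thesis
      using that u1(2) u2(2) unfolding less_3_iff by (elim disjE) (simp_all only: w)
  qed
  ultimately obtain v where v: "continuous_on (SG q) v"
    "\<And>i x. i < 3 \<Longrightarrow> x \<in> SG q \<Longrightarrow> v (F q i x) = w i x"
    using glue[of w] by blast
  have br: "x \<in> SG q" if "x \<in> bottom_row q n" for x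
    using that
  proof (induction n arbitrary: x)
    case 0
    then show ?case using vertex_in_SG[of 1] vertex_in_SG[of 2] by (auto simp: bottom_row_0)
  next
    case (Suc n)
    then show ?case using F_in_SG[of 1] F_in_SG[of 2] by (auto simp: bottom_row_Suc)
  qed
  have "v (q 0) = t" using v(2)[of 0 "q 0"] vertex_in_SG[of 0] u0(2)[of 0] by (simp add: w)
  moreover have "v x = f x" if "x \<in> bottom_row q (Suc n)" for x
    using that br u1(3) u2(3) v(2)[of 1] v(2)[of 2] w unfolding bottom_row_Suc by auto
  moreover have "graph_energy q m v = cell_energy (Suc n) t f" if m: "m \<ge> Suc n" for m
  proof -
    obtain k where k: "m = Suc k" "k \<ge> n" using Suc_le_D[OF m] m by auto
    have "graph_energy q k (v \<circ> F q i) = graph_energy q k (w i)" if "i < 3" for i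
      by (rule graph_energy_cong) (simp add: v that)
    from this[of 0] this[of 1] this[of 2] show ?thesis
      using sd[of y z] u0(3)[of k] u1(4)[OF k(2)] u2(4)[OF k(2)]
      unfolding k(1) graph_energy_Suc w by (simp add: y_def z_def)
  qed
  ultimately show ?case using v(1) by blast
qed

section \<open>Conductances\<close>

text \<open>A lower bound that is attained for all boundary values determines every least energy.
  Any conductances thus define the same form in differences, and its coefficients are
  unique.\<close>

lemma conductance_eqI:
  assumes A: "finite A" and c: "symmetric_on A c"
    and lower: "\<And>u. ereal (diff_form A c u) \<le> energy q u"
    and attained: "\<And>f. \<exists>u\<in>dom_energy q. (\<forall>x\<in>A. u x = f x) \<and> energy q u = ereal (diff_form A c f)"
  shows "conductance q A = c"
proof -
  have cong: "diff_form A d f = diff_form A d g" if "\<And>x. x \<in> A \<Longrightarrow> f x = g x" for d f g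
    unfolding diff_form_def using that by simp
  have 1: "is_conductances q A c"
    unfolding is_conductances_def diff_form_def[symmetric]
  proof (intro conjI allI impI)
    fix f u assume u: "least_energy_extension q A f u"
    obtain v where v: "v \<in> dom_energy q" "\<forall>x\<in>A. v x = f x" "energy q v = ereal (diff_form A c f)"
      using attained by blast
    have "energy q u \<le> energy q v" "diff_form A c f = diff_form A c u"
      using u v unfolding least_energy_extension_def by (auto intro!: cong)
    then show "energy q u = ereal (diff_form A c u)" using v lower[of u] by simp
  qed (use c in \<open>simp_all add: symmetric_on_def\<close>)
  have 2: "d = c" if d: "is_conductances q A d" for d
  proof (rule diff_form_coeff_unique[OF A])
    show "symmetric_on A d" using d by (simp add: is_conductances_def symmetric_on_def)
    show "diff_form A d f = diff_form A c f" for f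
    proof -
      obtain v where v: "v \<in> dom_energy q" "\<forall>x\<in>A. v x = f x" "energy q v = ereal (diff_form A c f)"
        using attained by blast
      have "energy q v \<le> energy q u" if "\<forall>x\<in>A. u x = f x" for u
        using lower[of u] cong[of u f c] that v by simp
      then have "least_energy_extension q A f v"
        using v by (simp add: least_energy_extension_def)
      then have "energy q v = ereal (diff_form A d v)"
        using d unfolding is_conductances_def diff_form_def by blast
      then show ?thesis using v cong[of v f d] by simp
    qed
  qed (rule c)
  show ?thesis unfolding conductance_def using 1 2 by (rule the_equality)
qed

section \<open>The mean and the energy form of the bottom row\<close>

lemma finite_bottom_row [simp]: "finite (bottom_row q n)"
  by (simp add: bottom_row_def)

lemma bottom_pt_in_row: "i \<le> 2^n \<Longrightarrow> bottom_pt q n i \<in> bottom_row q n"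
  by (simp add: bottom_row_def)

lemma bottom_pt_inject: "bottom_pt q n i = bottom_pt q n j \<longleftrightarrow> i = j"
  using vertices_distinct[of 1 2] by (auto simp: bottom_pt_def)

lemma top_notin_bottom_row: "q 0 \<notin> bottom_row q n"
proof -
  have "bary q 0 (bottom_pt q n i) = 0" for i
    by (simp add: bary_def area_def bottom_pt_def algebra_simps)
  then show ?thesis using bary_vertex[of 0 0] by (force simp: bottom_row_def)
qed

text \<open>The points \<open>p\<close> are left free so that the lemma covers each half of a longer
  row, too.\<close>

lemma is_lin_form_trapezoid:
  assumes "finite A" "\<And>i. i \<le> 2^n \<Longrightarrow> p i \<in> A"
  shows "is_lin_form A 1 (\<lambda>f. (\<Sum>i<2^n. f (p i) + f (p (Suc i))) / 2^(n+1))"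
proof -
  have "is_lin_form A (1 / 2^(n+1) * (\<Sum>i<(2::nat)^n. 1 + 1)) (\<lambda>f. 1 / 2^(n+1) * (\<Sum>i<2^n. f (p i) + f (p (Suc i))))"
    using assms by (intro is_lin_form_scale is_lin_form_sum is_lin_form_add is_lin_form_eval) auto
  then show ?thesis by simp
qed

lemma is_lin_form_row_mean: "is_lin_form (bottom_row q n) 1 (row_mean q n)"
  unfolding row_mean_def by (rule is_lin_form_trapezoid) (simp_all add: bottom_pt_in_row)

text \<open>The means of the two halves both have total weight 1, so their difference has total 0
  and its square is a form in differences.\<close>

lemma is_diff_form_row_energy: "is_diff_form (bottom_row q n) (row_energy q n)"
proof (induction n)
  case 0
  have "is_lin_form {q 1, q 2} (1 + (-1) * 1) (\<lambda>f. f (q 1) + (-1) * f (q 2))"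
    by (intro is_lin_form_add is_lin_form_scale is_lin_form_eval) auto
  then have "is_diff_form {q 1, q 2} (\<lambda>f. (f (q 1) - f (q 2))\<^sup>2)"
    using is_diff_form_square by simp
  from is_diff_form_scale[OF this, of "3/2"] show ?case by (simp add: bottom_row_0)
next
  case (Suc n)
  let ?A = "bottom_row q (Suc n)"
  have "is_lin_form ?A (1 + (-1) * 1) (\<lambda>f. row_mean q n (f \<circ> F q 1) + (-1) * row_mean q n (f \<circ> F q 2))"
    unfolding row_mean_def comp_apply bottom_pt_F1 bottom_pt_F2
    by (intro is_lin_form_add is_lin_form_scale is_lin_form_trapezoid)
      (auto intro!: bottom_pt_in_row is_lin_form_trapezoid[where p = "\<lambda>i. bottom_pt q (Suc n) (2^n + i)", simplified])
  then have "is_diff_form ?A (\<lambda>f. (row_mean q n (f \<circ> F q 1) - row_mean q n (f \<circ> F q 2))\<^sup>2)"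
    using is_diff_form_square by simp
  moreover have "is_diff_form ?A (\<lambda>f. row_energy q n (f \<circ> F q i))" if "i = 1 \<or> i = 2" for i
    by (rule is_diff_form_pullback[OF Suc]) (use that in \<open>auto simp: inj_on_def bottom_row_Suc\<close>)
  ultimately show ?case
    unfolding row_energy.simps by (intro is_diff_form_scale is_diff_form_add) auto
qed

text \<open>Every index except \<open>2^n\<close> is the left end of an interval, and every index
  except 0 is the right end of one.\<close>

lemma row_weight:
  assumes "i \<le> 2^n"
  shows "row_mean q n (indicator {bottom_pt q n i}) = (if i = 0 \<or> i = 2^n then 1 else 2) / 2^(n+1)"
proof -
  have "(\<Sum>k<2^n. indicator {bottom_pt q n i} (bottom_pt q n k) + indicator {bottom_pt q n i} (bottom_pt q n (Suc k))) =
    (\<Sum>k<2^n. if k = i then 1 else 0) + (\<Sum>k<2^n. if Suc k = i then 1 else 0 :: real)"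
    unfolding sum.distrib[symmetric] by (intro sum.cong) (auto simp: indicator_def bottom_pt_inject)
  also have "(\<Sum>k<2^n. if Suc k = i then 1 else 0 :: real) = (if i = 0 then 0 else 1)"
  proof (cases i)
    case (Suc j)
    then show ?thesis using assms by simp
  qed simp
  also have "(\<Sum>k<2^n. if k = i then 1 else 0 :: real) = (if i = 2^n then 0 else 1)"
    using assms by simp
  finally show ?thesis by (auto simp: row_mean_def)
qed

section \<open>The conductances with and without the top point\<close>

lemma dom_energyI: "continuous_on (SG q) u \<Longrightarrow> energy q u = ereal E \<Longrightarrow> u \<in> dom_energy q"
  by (simp add: dom_energy_def)

lemma cell_energy_le_energy: "ereal (cell_energy n (u (q 0)) u) \<le> energy q u"
  using graph_energy_ge_cell_energy[of n u] graph_energy_le_energy[of n u] by (meson ereal_less_eq(3) order_trans)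

lemma cell_energy_attained_energy:
  "\<exists>u\<in>dom_energy q. u (q 0) = t \<and> (\<forall>x\<in>bottom_row q n. u x = f x) \<and> energy q u = ereal (cell_energy n t f)"
proof -
  obtain u where u: "continuous_on (SG q) u" "u (q 0) = t" "\<forall>x\<in>bottom_row q n. u x = f x"
    "\<And>m. m \<ge> n \<Longrightarrow> graph_energy q m u = cell_energy n t f"
    using cell_energy_attained[of t n f] by blast
  then have "energy q u = ereal (cell_energy n t f)" by (intro energy_eqI)
  with u dom_energyI show ?thesis by blast
qed

text \<open>With the top value free, the choice \<open>t = row_mean q n f\<close> removes the square
  weighted by \<open>alpha n\<close> and leaves \<open>row_energy\<close>.\<close>

lemma conductance_bottom_row:
  assumes "symmetric_on (bottom_row q n) c" "\<And>f. row_energy q n f = diff_form (bottom_row q n) c f"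
  shows "conductance q (bottom_row q n) = c"
proof (rule conductance_eqI)
  fix u :: "real^2 \<Rightarrow> real"
  have "row_energy q n u \<le> cell_energy n (u (q 0)) u"
    using alpha_pos[of n] by (simp add: cell_energy_def)
  then show "ereal (diff_form (bottom_row q n) c u) \<le> energy q u"
    using cell_energy_le_energy[of n u] assms(2) by (metis ereal_less_eq(3) order_trans)
next
  fix f :: "real^2 \<Rightarrow> real"
  show "\<exists>u\<in>dom_energy q. (\<forall>x\<in>bottom_row q n. u x = f x) \<and> energy q u = ereal (diff_form (bottom_row q n) c f)"
    using cell_energy_attained_energy[of "row_mean q n f" n f] assms(2) by (auto simp: cell_energy_def)
qed (use assms in auto)

lemma conductance_bottom_row_top:
  assumes c: "symmetric_on (bottom_row q n) c" "\<And>f. row_energy q n f = diff_form (bottom_row q n) c f"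
    and w: "\<And>x. w x = row_mean q n (indicator {x})"
  shows "x \<in> bottom_row q n \<Longrightarrow> y \<in> bottom_row q n \<Longrightarrow> x \<noteq> y \<Longrightarrow>
      conductance q (bottom_row q n \<union> {q 0}) x y = c x y - alpha n * w x * w y"
    and "x \<in> bottom_row q n \<Longrightarrow> conductance q (bottom_row q n \<union> {q 0}) (q 0) x = alpha n * w x"
proof -
  define B where "B = bottom_row q n"
  have B: "finite B" "q 0 \<notin> B" by (simp_all add: B_def top_notin_bottom_row)
  define al where "al = alpha n"
  define k where "k = (\<lambda>x y. if x \<in> B \<and> y \<in> B \<and> x \<noteq> y then c x y - al * w x * w y
     else if x = q 0 \<and> y \<in> B then al * w y else if y = q 0 \<and> x \<in> B then al * w x else 0)"
  have wsum: "sum w B = 1" and wmean: "row_mean q n f = (\<Sum>x\<in>B. w x * f x)" for f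
    using is_lin_form_coeff[OF finite_bottom_row is_lin_form_row_mean] unfolding B_def w by blast+
  have sym: "symmetric_on (B \<union> {q 0}) k"
    using c(1) B unfolding symmetric_on_def k_def B_def[symmetric] by (auto simp: mult_ac)
  have form: "cell_energy n (f (q 0)) f = diff_form (B \<union> {q 0}) k f" for f
  proof -
    \<comment> \<open>Subtracting the top value does not change differences within the row. The
      variance identity for \<open>g\<close> then yields the terms joining the row to the top and
      the square of the distance from \<open>f (q 0)\<close> to the mean.\<close>
    define g where "g = (\<lambda>x. f x - f (q 0))"
    have "(\<Sum>y\<in>B. k x y * (f x - f y)\<^sup>2) = (\<Sum>y\<in>B. c x y * (f x - f y)\<^sup>2 - al * (w x * w y * (g x - g y)\<^sup>2))"
      if "x \<in> B" for x
      using that by (intro sum.cong) (auto simp: k_def g_def algebra_simps)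
    then have "(\<Sum>x\<in>B. \<Sum>y\<in>B. k x y * (f x - f y)\<^sup>2) =
      2 * diff_form B c f - al * (\<Sum>x\<in>B. \<Sum>y\<in>B. w x * w y * (g x - g y)\<^sup>2)"
      by (simp add: diff_form_def sum_subtractf flip: sum_distrib_left)
    also have "(\<Sum>x\<in>B. \<Sum>y\<in>B. w x * w y * (g x - g y)\<^sup>2) =
        2 * ((\<Sum>x\<in>B. w x * (g x)\<^sup>2) - (\<Sum>x\<in>B. w x * g x)\<^sup>2)"
      using sum_pair_weights[of w g B] by (simp add: wsum)
    also have "(\<Sum>x\<in>B. w x * g x) = row_mean q n f - f (q 0)"
      by (simp add: wmean g_def right_diff_distrib sum_subtractf wsum flip: sum_distrib_right)
    finally have BB: "(\<Sum>x\<in>B. \<Sum>y\<in>B. k x y * (f x - f y)\<^sup>2) =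
      2 * diff_form B c f - 2 * al * (\<Sum>x\<in>B. w x * (g x)\<^sup>2) + 2 * al * (f (q 0) - row_mean q n f)\<^sup>2"
      by (simp add: algebra_simps power2_commute)
    have top: "(\<Sum>y\<in>B. k (q 0) y * (f (q 0) - f y)\<^sup>2) = al * (\<Sum>x\<in>B. w x * (g x)\<^sup>2)"
      "(\<Sum>x\<in>B. k x (q 0) * (f x - f (q 0))\<^sup>2) = al * (\<Sum>x\<in>B. w x * (g x)\<^sup>2)"
      unfolding sum_distrib_left using B
      by (auto intro!: sum.cong simp: k_def g_def power2_commute)
    have "(\<Sum>x\<in>B \<union> {q 0}. \<Sum>y\<in>B \<union> {q 0}. k x y * (f x - f y)\<^sup>2) =
      (\<Sum>x\<in>B. \<Sum>y\<in>B. k x y * (f x - f y)\<^sup>2) + (\<Sum>y\<in>B. k (q 0) y * (f (q 0) - f y)\<^sup>2)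
        + (\<Sum>x\<in>B. k x (q 0) * (f x - f (q 0))\<^sup>2)"
      using B by (simp add: sum.distrib)
    then have "diff_form (B \<union> {q 0}) k f = diff_form B c f + al * (f (q 0) - row_mean q n f)\<^sup>2"
      unfolding BB top diff_form_def[of "B \<union> {q 0}"] by simp
    then show ?thesis
      using c(2)[of f] by (simp only: cell_energy_def al_def B_def add.commute)
  qed
  have K: "conductance q (B \<union> {q 0}) = k"
  proof (rule conductance_eqI[OF _ sym])
    show "ereal (diff_form (B \<union> {q 0}) k u) \<le> energy q u" for u
      using cell_energy_le_energy[of n u] form[of u] by simp
    show "\<exists>u\<in>dom_energy q. (\<forall>x\<in>B \<union> {q 0}. u x = f x) \<and> energy q u = ereal (diff_form (B \<union> {q 0}) k f)" for f
      using cell_energy_attained_energy[of "f (q 0)" n f] form[of f] by (auto simp: B_def)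
  qed (use B in simp)
  show "conductance q (bottom_row q n \<union> {q 0}) x y = c x y - alpha n * w x * w y"
    if "x \<in> bottom_row q n" "y \<in> bottom_row q n" "x \<noteq> y"
    using that K by (simp add: B_def k_def al_def)
  show "conductance q (bottom_row q n \<union> {q 0}) (q 0) x = alpha n * w x" if "x \<in> bottom_row q n"
    using that K B by (simp add: B_def k_def al_def)
qed

text \<open>The corner weight is \<open>1 / 2^(n+1)\<close>, so \<open>a_top q n\<close> is
  \<open>alpha n / 2^(n+1)\<close>. The correction \<open>alpha n\<close> times two weights is
  expressed through it, with a factor 2 for each inner point.\<close>

lemma c_bottom_eq:
  assumes "i < j" "j \<le> 2^n"
  shows "c_bottom q n i j = c_bottom_top q n i j +
    a_top q n * (if i = 0 then 1 else 2) * (if j = 2^n then 1 else 2) / 2^(n+1)"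
proof -
  obtain c where c: "symmetric_on (bottom_row q n) c" "\<And>f. row_energy q n f = diff_form (bottom_row q n) c f"
    using is_diff_form_row_energy unfolding is_diff_form_def by blast
  define w where "w = (\<lambda>x. row_mean q n (indicator {x}))"
  have w: "w x = row_mean q n (indicator {x})" for x by (simp add: w_def)
  note top = conductance_bottom_row_top[OF c w]
  have "a_top q n = alpha n * w (bottom_pt q n 0)"
    unfolding a_top_def by (rule top(2)) (simp add: bottom_pt_in_row)
  moreover have "c_bottom_top q n i j = c (bottom_pt q n i) (bottom_pt q n j) - alpha n * w (bottom_pt q n i) * w (bottom_pt q n j)"
    unfolding c_bottom_top_def using assms by (intro top(1)) (simp_all add: bottom_pt_in_row bottom_pt_inject)
  moreover have "c_bottom q n i j = c (bottom_pt q n i) (bottom_pt q n j)"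
    by (simp add: c_bottom_def conductance_bottom_row[OF c])
  ultimately show ?thesis
    using assms by (auto simp: w row_weight)
qed

end

theorem lemma2p22:
  fixes q :: "nat \<Rightarrow> real^2" and n :: nat
  assumes "equilateral q"
  shows "c_bottom q n 0 (2^n) = c_bottom_top q n 0 (2^n) + a_top q n / 2^(n+1) \<and>
    (\<forall>j. 0 < j \<and> j < 2^n \<longrightarrow>
       c_bottom q n 0 j = c_bottom_top q n 0 j + a_top q n / 2^n) \<and>
    (\<forall>i j. 0 < i \<and> i < j \<and> j < 2^n \<longrightarrow>
       c_bottom q n i j = c_bottom_top q n i j + a_top q n / 2^(n-1))"
proof -
  interpret gasket q by unfold_locales (rule assms)
  show ?thesis
  proof (intro conjI allI impI; (elim conjE)?)
    show "c_bottom q n 0 (2^n) = c_bottom_top q n 0 (2^n) + a_top q n / 2^(n+1)"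
      using c_bottom_eq[of 0 "2^n" n] by simp
    show "c_bottom q n 0 j = c_bottom_top q n 0 j + a_top q n / 2^n" if "0 < j" "j < 2^n" for j
      using c_bottom_eq[of 0 j n] that by simp
    show "c_bottom q n i j = c_bottom_top q n i j + a_top q n / 2^(n - 1)" if ij: "0 < i" "i < j" "j < 2^n" for i j
    proof -
      \<comment> \<open>Two distinct inner indices force \<open>n > 0\<close>, so the truncated
        subtraction in \<open>n - 1\<close> is a true one.\<close>
      obtain k where "n = Suc k" using ij by (cases n) auto
      then show ?thesis using c_bottom_eq[of i j n] ij by simp
    qed
  qed
qed

end
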